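(* Let $A=\Bbbk Q/I$ be a string or locally string algebra over a field $\Bbbk$. Then $\operatorname{Aut}(A)=\widehat H_A\cdot\operatorname{Inn}^*(A)$, i.e. every $\Bbbk$-algebra automorphism of $A$ is a composition of an element of $\widehat H_A$ and an element of $\operatorname{Inn}^*(A)$.
   Context: Quivers $Q=(Q_0,Q_1,s,t)$ are finite, connected, with at least one arrow. A path of length $n\ge 1$ is $p=\alpha_1\cdots\alpha_n$ with $\alpha_i\in Q_1$, $t(\alpha_i)=s(\alpha_{i+1})$; for each vertex $v$ there is a stationary path $\epsilon_v$ of length $0$. $\Bbbk Q$ is the path algebra (product = concatenation). $A=\Bbbk Q/I$ is a string algebra if: (i) every vertex has in-degree $\le 2$ and out-degree $\le 2$; (ii) whenever $s(\alpha)=t(\beta)=t(\beta')$ with $\beta\ne\beta'$ arrows, at least one of $\beta\alpha,\beta'\alpha$ is in $I$; (iii) whenever $t(\alpha)=s(\beta)=s(\beta')$ with $\beta\neq\beta'$, at least one of $\alpha\beta,\alpha\beta'$ is in $I$; (iv) $I$ is generated by paths (of length at least two); (v) $A$ is finite-dimensional. It is locally string if it satisfies (i)-(iv) and is infinite-dimensional. $\Bbbk Q_0\subseteq A$ is the span of the stationary paths and $A_+$ is the span of the nonstationary paths not in $I$. $\widehat H_A=\{\phi\in\operatorname{Aut}(A):\phi(\Bbbk Q_0)\subseteq\Bbbk Q_0\}$. For a unit $u$, $\Delta_u(z)=u^{-1}zu$, and $\operatorname{Inn}^*(A)=\{\Delta_{1+y}: y\in A_+,\ 1+y\in A^\times\}$.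 *)

theory Defs
  imports
    "HOL-Algebra.QuotRing"
    "HOL-Algebra.Module"
    "HOL-Algebra.Bij"
    "HOL-Library.Poly_Mapping"
    "Graph_Theory.Digraph_Component"
begin

section \<open>Quivers and paths\<close>

text \<open>The vertices, arrows, source and target of a quiver are the fields \<^const>\<open>verts\<close>,
  \<^const>\<open>arcs\<close>, \<^const>\<open>tail\<close> and \<^const>\<open>head\<close> of a \<^typ>\<open>('v, 'e) pre_digraph\<close>; loops and
  parallel arrows are allowed, and connectedness ignores the orientation of the arrows.\<close>

locale quiver = fin_digraph Q for Q :: "('v, 'e) pre_digraph" +
  assumes connected: "Digraph_Component.connected Q"
    and arcs_nonempty: "arcs Q \<noteq> {}"

text \<open>A path is stored as its source together with its list of arrows, read from left to right.
  The source is needed to tell the stationary paths \<open>(v, [])\<close> apart.\<close>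

type_synonym ('v, 'e) qpath = "'v \<times> 'e list"

definition path_target :: "('v, 'e) pre_digraph \<Rightarrow> ('v, 'e) qpath \<Rightarrow> 'v" where
  "path_target Q p = pre_digraph.awlast Q (fst p) (snd p)"

definition paths :: "('v, 'e) pre_digraph \<Rightarrow> ('v, 'e) qpath set" where
  "paths Q = {p. pre_digraph.awalk Q (fst p) (snd p) (path_target Q p)}"

definition path_length :: "('v, 'e) qpath \<Rightarrow> nat" where
  "path_length p = length (snd p)"

definition stationary :: "'v \<Rightarrow> ('v, 'e) qpath" where
  "stationary v = (v, [])"

section \<open>Linear spans\<close>

text \<open>The scalars form a type \<open>'k\<close>, so that scalar multiplication is defined for all of \<open>'k\<close>.\<close>

definition lin_span :: "('k, 'a, 'm) module_scheme \<Rightarrow> 'a set \<Rightarrow> 'a set" where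
  "lin_span A S = {(\<Oplus>\<^bsub>A\<^esub>x\<in>F. c x \<odot>\<^bsub>A\<^esub> x) | c F. finite F \<and> F \<subseteq> S}"

definition finite_dimensional :: "('k, 'a, 'm) module_scheme \<Rightarrow> bool" where
  "finite_dimensional A \<longleftrightarrow> (\<exists>B. finite B \<and> B \<subseteq> carrier A \<and> lin_span A B = carrier A)"

section \<open>Path algebras and their quotients\<close>

abbreviation path_vec :: "('v, 'e) qpath \<Rightarrow> ('v, 'e) qpath \<Rightarrow>\<^sub>0 'k::field" where
  "path_vec p \<equiv> Poly_Mapping.single p 1"

text \<open>Bilinear extension of the concatenation of paths; paths that do not match multiply to \<open>0\<close>.\<close>

definition path_mult ::
    "('v, 'e) pre_digraph \<Rightarrow> (('v, 'e) qpath \<Rightarrow>\<^sub>0 'k::field) \<Rightarrow> (('v, 'e) qpath \<Rightarrow>\<^sub>0 'k) \<Rightarrow> (('v, 'e) qpath \<Rightarrow>\<^sub>0 'k)"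
  where
  "path_mult Q f g =
    (\<Sum>p\<in>Poly_Mapping.keys f. \<Sum>q\<in>Poly_Mapping.keys g.
      if path_target Q p = fst q
      then Poly_Mapping.single (fst p, snd p @ snd q) (Poly_Mapping.lookup f p * Poly_Mapping.lookup g q)
      else 0)"

definition path_algebra ::
    "('v, 'e) pre_digraph \<Rightarrow> ('k::field, ('v, 'e) qpath \<Rightarrow>\<^sub>0 'k) module" where
  "path_algebra Q =
    \<lparr>carrier = {f. Poly_Mapping.keys f \<subseteq> paths Q},
     monoid.mult = path_mult Q,
     one = (\<Sum>v\<in>verts Q. path_vec (stationary v)),
     zero = 0,
     add = (+),
     smult = (\<lambda>c. Poly_Mapping.map ((*) c))\<rparr>"

text \<open>The union defining scalar multiplication is a single coset when \<open>I\<close> is an ideal;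
  compare \<^const>\<open>rcoset_mult\<close>, the product of \<^const>\<open>FactRing\<close>.\<close>

definition quotient_algebra :: "('k, 'a, 'm) module_scheme \<Rightarrow> 'a set \<Rightarrow> ('k, 'a set) module" where
  "quotient_algebra R I =
    \<lparr>carrier = carrier (R Quot I),
     monoid.mult = monoid.mult (R Quot I),
     one = one (R Quot I),
     zero = zero (R Quot I),
     add = add (R Quot I),
     smult = (\<lambda>c X. \<Union>x\<in>X. I +>\<^bsub>R\<^esub> (c \<odot>\<^bsub>R\<^esub> x))\<rparr>"

definition quiver_algebra ::
    "('v, 'e) pre_digraph \<Rightarrow> (('v, 'e) qpath \<Rightarrow>\<^sub>0 'k::field) set
      \<Rightarrow> ('k, (('v, 'e) qpath \<Rightarrow>\<^sub>0 'k) set) module" where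
  "quiver_algebra Q I = quotient_algebra (path_algebra Q) I"

definition path_class ::
    "('v, 'e) pre_digraph \<Rightarrow> (('v, 'e) qpath \<Rightarrow>\<^sub>0 'k::field) set \<Rightarrow> ('v, 'e) qpath
      \<Rightarrow> (('v, 'e) qpath \<Rightarrow>\<^sub>0 'k) set" where
  "path_class Q I p = I +>\<^bsub>path_algebra Q\<^esub> path_vec p"

section \<open>String and locally string algebras\<close>

locale string_relations = quiver Q
  for Q :: "('v, 'e) pre_digraph" +
  fixes I :: "(('v, 'e) qpath \<Rightarrow>\<^sub>0 'k::field) set"
  assumes in_degree_le: "v \<in> verts Q \<Longrightarrow> in_degree Q v \<le> 2"
    and out_degree_le: "v \<in> verts Q \<Longrightarrow> out_degree Q v \<le> 2"
    and incoming_relation: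
      "\<lbrakk>\<alpha> \<in> arcs Q; \<beta> \<in> arcs Q; \<beta>' \<in> arcs Q; \<beta> \<noteq> \<beta>'; tail Q \<alpha> = head Q \<beta>; tail Q \<alpha> = head Q \<beta>'\<rbrakk>
        \<Longrightarrow> path_vec (tail Q \<beta>, [\<beta>, \<alpha>]) \<in> I \<or> path_vec (tail Q \<beta>', [\<beta>', \<alpha>]) \<in> I"
    and outgoing_relation:
      "\<lbrakk>\<alpha> \<in> arcs Q; \<beta> \<in> arcs Q; \<beta>' \<in> arcs Q; \<beta> \<noteq> \<beta>'; head Q \<alpha> = tail Q \<beta>; head Q \<alpha> = tail Q \<beta>'\<rbrakk>
        \<Longrightarrow> path_vec (tail Q \<alpha>, [\<alpha>, \<beta>]) \<in> I \<or> path_vec (tail Q \<alpha>, [\<alpha>, \<beta>']) \<in> I"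
    and generated_by_paths:
      "\<exists>P. P \<subseteq> {p \<in> paths Q. path_length p \<ge> 2} \<and> I = Idl\<^bsub>path_algebra Q\<^esub> (path_vec ` P)"

locale string_algebra = string_relations Q I
  for Q :: "('v, 'e) pre_digraph" and I :: "(('v, 'e) qpath \<Rightarrow>\<^sub>0 'k::field) set" +
  assumes finite_dim: "finite_dimensional (quiver_algebra Q I)"

locale locally_string_algebra = string_relations Q I
  for Q :: "('v, 'e) pre_digraph" and I :: "(('v, 'e) qpath \<Rightarrow>\<^sub>0 'k::field) set" +
  assumes infinite_dim: "\<not> finite_dimensional (quiver_algebra Q I)"

section \<open>Automorphisms\<close>

definition alg_auto :: "('k, 'a, 'm) module_scheme \<Rightarrow> ('a \<Rightarrow> 'a) set" where
  "alg_auto A =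
    {\<phi> \<in> ring_hom A A \<inter> Bij (carrier A). \<forall>c. \<forall>x\<in>carrier A. \<phi> (c \<odot>\<^bsub>A\<^esub> x) = c \<odot>\<^bsub>A\<^esub> \<phi> x}"

text \<open>The product of \<open>\<phi>\<close> and \<open>\<psi>\<close> in this group is \<open>\<phi> \<circ> \<psi>\<close>, restricted to the carrier.\<close>

definition AutAlg :: "('k, 'a, 'm) module_scheme \<Rightarrow> ('a \<Rightarrow> 'a) monoid" where
  "AutAlg A = BijGroup (carrier A)\<lparr>carrier := alg_auto A\<rparr>"

definition stationary_span ::
    "('v, 'e) pre_digraph \<Rightarrow> (('v, 'e) qpath \<Rightarrow>\<^sub>0 'k::field) set \<Rightarrow> (('v, 'e) qpath \<Rightarrow>\<^sub>0 'k) set set" where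
  "stationary_span Q I = lin_span (quiver_algebra Q I) (path_class Q I ` stationary ` verts Q)"

definition A_plus ::
    "('v, 'e) pre_digraph \<Rightarrow> (('v, 'e) qpath \<Rightarrow>\<^sub>0 'k::field) set \<Rightarrow> (('v, 'e) qpath \<Rightarrow>\<^sub>0 'k) set set" where
  "A_plus Q I = lin_span (quiver_algebra Q I)
    (path_class Q I ` {p \<in> paths Q. path_length p \<ge> 1 \<and> path_vec p \<notin> I})"

definition H_hat ::
    "('v, 'e) pre_digraph \<Rightarrow> (('v, 'e) qpath \<Rightarrow>\<^sub>0 'k::field) set
      \<Rightarrow> ((('v, 'e) qpath \<Rightarrow>\<^sub>0 'k) set \<Rightarrow> (('v, 'e) qpath \<Rightarrow>\<^sub>0 'k) set) set" where
  "H_hat Q I = {\<phi> \<in> alg_auto (quiver_algebra Q I). \<phi> ` stationary_span Q I \<subseteq> stationary_span Q I}"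

definition conj_map :: "('a, 'm) ring_scheme \<Rightarrow> 'a \<Rightarrow> 'a \<Rightarrow> 'a" where
  "conj_map A u = (\<lambda>z\<in>carrier A. inv\<^bsub>A\<^esub> u \<otimes>\<^bsub>A\<^esub> z \<otimes>\<^bsub>A\<^esub> u)"

definition Inn_star ::
    "('v, 'e) pre_digraph \<Rightarrow> (('v, 'e) qpath \<Rightarrow>\<^sub>0 'k::field) set
      \<Rightarrow> ((('v, 'e) qpath \<Rightarrow>\<^sub>0 'k) set \<Rightarrow> (('v, 'e) qpath \<Rightarrow>\<^sub>0 'k) set) set" where
  "Inn_star Q I =
    {conj_map (quiver_algebra Q I) (\<one>\<^bsub>quiver_algebra Q I\<^esub> \<oplus>\<^bsub>quiver_algebra Q I\<^esub> y) | y.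
      y \<in> A_plus Q I \<and>
      \<one>\<^bsub>quiver_algebra Q I\<^esub> \<oplus>\<^bsub>quiver_algebra Q I\<^esub> y \<in> Units (quiver_algebra Q I)}"

end

theory Submission
  imports Defs "HOL-Computational_Algebra.Polynomial"
begin

text \<open>An automorphism \<open>\<phi>\<close> is determined up to \<open>H_hat\<close> by the idempotents
\<open>f v = \<phi>\<^sup>-\<^sup>1 (e v)\<close>, where \<open>e v\<close> is the stationary path at \<open>v\<close>. If a unit
\<open>u \<in> 1 + A_+\<close> conjugates the \<open>e v\<close> to a permutation of the \<open>f v\<close>, then
\<open>\<phi>\<close> precomposed with that conjugation permutes the \<open>e v\<close>, which is the factorization wanted.
So everything is about one assertion: in a string or locally string algebra any complete system of
nonzero orthogonal idempotents, indexed by the vertices, is conjugate under \<open>1 + A_+\<close> to a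
permutation of the stationary paths (\<open>idempotents_conjugate\<close>).

The relations are monomial, so the nonzero paths form a basis, and \<open>A\<close> is the space of finitely
supported functions on them with a truncated convolution. An idempotent in \<open>A_+\<close> vanishes, because
its shortest path would have to be a product of shorter ones; hence modulo \<open>A_+\<close> the \<open>f v\<close>
are a permutation of the \<open>e v\<close> (\<open>idempotents_relabel\<close>), and we may assume
\<open>f v - e v \<in> A_+\<close>.

The string conditions say that an arrow has at most one successor and at most one predecessor with
nonzero product. Therefore an arrow that starts arbitrarily long nonzero paths lies on a cycle of arrows,
all of whose powers are nonzero, and every nonzero path through one of its arrows runs along it. The paths that
start with one of the remaining arrows have bounded length and span a nilpotent ideal. If all
\<open>f v - e v\<close> are in that ideal, then \<open>\<Sum>v. e v f v\<close> is a unit that conjugates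
(\<open>straighten_nil\<close>).

It remains to remove the cyclic part, one cycle at a time. For a cycle with \<open>n\<close> arrows, let the
monomial \<open>X\<^sup>j\<close> stand for the \<open>j\<close>-th position on the unrolled cycle. Then \<open>A\<close>
acts on \<open>k[X]\<close> by linear maps that commute with multiplication by \<open>X\<^sup>n\<close> and do not
decrease the order at \<open>0\<close>; the paths on the cycle give exactly the periodic maps that increase
the order. The image of \<open>f v\<close> is a direct summand of a free module over the principal ideal
domain \<open>k[X\<^sup>n]\<close>, and free generators of it can be normalized at \<open>X = 0\<close>. Collecting them
yields an invertible periodic map that conjugates all \<open>f v\<close> to the \<open>e v\<close> simultaneously
(\<open>simultaneous_conjugation\<close>); it is the action of a unit in \<open>1 + A_+\<close>
(\<open>straighten_cycle\<close>).\<close>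

section \<open>Linear maps on polynomials\<close>

definition lin_ext :: "(nat \<Rightarrow> 'k::field poly) \<Rightarrow> 'k poly \<Rightarrow> 'k poly" where
  "lin_ext b q = (\<Sum>j\<le>degree q. smult (coeff q j) (b j))"

lemma lin_ext_conv: "degree q \<le> N \<Longrightarrow> lin_ext b q = (\<Sum>j\<le>N. smult (coeff q j) (b j))"
  unfolding lin_ext_def by (rule sum.mono_neutral_left) (auto simp: coeff_eq_0)

lemma smult_sum_right: "smult a (\<Sum>x\<in>X. h x) = (\<Sum>x\<in>X. smult a (h x))"
  by (induction X rule: infinite_finite_induct) (simp_all add: smult_add_right)

lemma lin_ext_add: "lin_ext b (p + q) = lin_ext b p + lin_ext b q"
proof -
  let ?N = "max (degree p) (degree q)"
  have "degree (p + q) \<le> ?N" by (rule degree_add_le) auto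
  then show ?thesis
    by (simp add: lin_ext_conv[where N = ?N] smult_add_left sum.distrib)
qed

lemma lin_ext_smult: "lin_ext b (smult a p) = smult a (lin_ext b p)"
proof -
  have "degree (smult a p) \<le> degree p" by (rule degree_smult_le)
  then show ?thesis
    by (simp add: lin_ext_conv[where N = "degree p"] smult_sum_right)
qed

lemma lin_ext_monom: "lin_ext b (monom 1 j) = b j"
proof -
  have "lin_ext b (monom 1 j) = (\<Sum>i\<le>j. smult (coeff (monom 1 j) i) (b i))"
    by (rule lin_ext_conv) (rule degree_monom_le)
  also have "\<dots> = (\<Sum>i\<le>j. if i = j then b j else 0)"
    by (rule sum.cong) auto
  finally show ?thesis by simp
qed

locale poly_linear =
  fixes f :: "'k::field poly \<Rightarrow> 'k poly"
  assumes add: "f (p + q) = f p + f q"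
    and smult: "f (smult a p) = smult a (f p)"
begin

lemma zero: "f 0 = 0"
  using smult[of 0 0] by simp

lemma diff: "f (p - q) = f p - f q"
  using add[of p "smult (-1) q"] smult[of "-1" q] by simp

lemma sum: "f (\<Sum>x\<in>X. g x) = (\<Sum>x\<in>X. f (g x))"
  by (induction X rule: infinite_finite_induct) (simp_all add: zero add)

lemma eq_lin_ext: "f = lin_ext (\<lambda>j. f (monom 1 j))"
proof
  fix q
  have "f q = f (\<Sum>j\<le>degree q. smult (coeff q j) (monom 1 j))"
    by (simp add: poly_as_sum_of_monoms smult_monom)
  then show "f q = lin_ext (\<lambda>j. f (monom 1 j)) q"
    by (simp add: sum smult lin_ext_def)
qed

end

lemma poly_linear_lin_ext: "poly_linear (lin_ext b)"
  by unfold_locales (simp_all add: lin_ext_add lin_ext_smult)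

lemma poly_linear_eqI:
  assumes "poly_linear f" "poly_linear g" "\<And>j. f (monom 1 j) = g (monom 1 j)"
  shows "f = g"
  using poly_linear.eq_lin_ext[OF assms(1)] poly_linear.eq_lin_ext[OF assms(2)] assms(3) by simp

text \<open>The matrix of \<open>f\<close> in the basis of monomials is triangular: \<open>f\<close> does not decrease the order at
\<open>0\<close>, and \<open>d\<close> is its diagonal.\<close>
definition lower_coeffs :: "('k::field poly \<Rightarrow> 'k poly) \<Rightarrow> (nat \<Rightarrow> 'k) \<Rightarrow> bool" where
  "lower_coeffs f d \<longleftrightarrow> (\<forall>j k. k \<le> j \<longrightarrow> coeff (f (monom 1 j)) k = (if k = j then d j else 0))"

text \<open>A triangular map acts on the lowest term of a polynomial through its diagonal.\<close>
lemma lower_coeffsD: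
  assumes "poly_linear f" "lower_coeffs f d" "\<And>i. i < k \<Longrightarrow> coeff q i = 0"
  shows "i < k \<Longrightarrow> coeff (f q) i = 0" "coeff (f q) k = d k * coeff q k"
proof -
  have *: "coeff (f q) i = (if i = k then d k * coeff q k else 0)" if "i \<le> k" for i
  proof -
    have "coeff (f q) i = (\<Sum>j\<le>degree q. coeff q j * coeff (f (monom 1 j)) i)"
      by (subst poly_linear.eq_lin_ext[OF assms(1)]) (simp add: lin_ext_def coeff_sum)
    also have "\<dots> = (\<Sum>j\<le>degree q. if j = k then (if i = k then d k * coeff q k else 0) else 0)"
      using assms(2,3) that unfolding lower_coeffs_def
      by (intro sum.cong refl) (metis antisym le_trans mult.commute mult_eq_0_iff nat_le_linear not_le)
    finally show ?thesis
      by (auto simp: coeff_eq_0 not_le)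
  qed
  show "i < k \<Longrightarrow> coeff (f q) i = 0" "coeff (f q) k = d k * coeff q k"
    using *[of i] *[of k] by auto
qed

locale periodic_map = poly_linear f for f :: "'k::field poly \<Rightarrow> 'k poly" +
  fixes n :: nat
  assumes shift: "f (monom 1 n * p) = monom 1 n * f p"

lemma lin_ext_periodic:
  assumes "\<And>j. b (j + n) = monom 1 n * b j"
  shows "periodic_map (lin_ext b) n"
proof -
  note lin = poly_linear_lin_ext[of b]
  have lin1: "poly_linear (\<lambda>p. lin_ext b (monom 1 n * p))"
    and lin2: "poly_linear (\<lambda>p. monom 1 n * lin_ext b p)"
    by (unfold_locales; simp add: distrib_left poly_linear.add[OF lin] poly_linear.smult[OF lin])+
  have "(\<lambda>p. lin_ext b (monom 1 n * p)) = (\<lambda>p. monom 1 n * lin_ext b p)"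
    by (rule poly_linear_eqI[OF lin1 lin2]) (simp add: mult_monom lin_ext_monom assms[symmetric] add.commute)
  then have "lin_ext b (monom 1 n * p) = monom 1 n * lin_ext b p" for p by meson
  then show ?thesis by (simp add: periodic_map_def periodic_map_axioms_def lin)
qed

lemma periodic_map_eqI:
  fixes f g :: "'k::field poly \<Rightarrow> 'k poly"
  assumes "periodic_map f n" "periodic_map g n" "\<And>j. j < n \<Longrightarrow> f (monom 1 j) = g (monom 1 j)" "0 < n"
  shows "f = g"
proof (rule poly_linear_eqI)
  show "poly_linear f" "poly_linear g" using assms by (simp_all add: periodic_map_def)
  fix j
  show "f (monom 1 j) = g (monom 1 j)"
  proof (induction j rule: less_induct)
    case (less j)
    show ?case
    proof (cases "j < n")
      case False
      then have "(monom 1 j :: 'k poly) = monom 1 n * monom 1 (j - n)" by (simp add: mult_monom)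
      then show ?thesis
        using less.IH[of "j - n"] False assms(4)
        by (simp add: periodic_map.shift[OF assms(1)] periodic_map.shift[OF assms(2)])
    qed (rule assms(3))
  qed
qed

lemma coeff_lin_ext:
  assumes "\<And>i k. k < i \<Longrightarrow> coeff (b i) k = 0"
  shows "coeff (lin_ext b q) m = (\<Sum>i\<le>m. coeff q i * coeff (b i) m)"
proof -
  have "coeff (lin_ext b q) m = (\<Sum>i\<le>max m (degree q). coeff q i * coeff (b i) m)"
    by (simp add: lin_ext_conv[of q "max m (degree q)"] coeff_sum)
  also have "\<dots> = (\<Sum>i\<le>m. coeff q i * coeff (b i) m)"
    by (rule sum.mono_neutral_right) (auto simp: assms)
  finally show ?thesis .
qed

section \<open>Orthogonal idempotents that commute with a power of the variable\<close>

text \<open>Over the principal ideal domain \<open>k[X\<^sup>n]\<close> the module \<open>k[X]\<close> is free on \<open>1, X, \<dots>, X\<^sup>n\<^sup>-\<^sup>1\<close>.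
The maps \<open>F v\<close> split it into a direct sum, and on lowest terms they look like the coordinate
projections that belong to the labelling \<open>lab\<close> of the positions.\<close>
locale periodic_idempotents =
  fixes n :: nat and S :: "'v set" and F :: "'v \<Rightarrow> 'k::field poly \<Rightarrow> 'k poly" and lab :: "nat \<Rightarrow> 'v"
  assumes n_pos: "0 < n" and finite_S: "finite S"
    and periodic: "v \<in> S \<Longrightarrow> periodic_map (F v) n"
    and orth: "v \<in> S \<Longrightarrow> w \<in> S \<Longrightarrow> F v (F w p) = (if v = w then F v p else 0)"
    and total: "(\<Sum>v\<in>S. F v p) = p"
    and diag: "v \<in> S \<Longrightarrow> lower_coeffs (F v) (\<lambda>j. if lab j = v then 1 else 0)"
    and lab_period: "lab (j + n) = lab j"
    and lab_in: "lab j \<in> S"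
begin

abbreviation Z :: "'k poly" where "Z \<equiv> monom 1 n"

definition M :: "'v \<Rightarrow> 'k poly set" where
  "M v = {q. F v q = q}"

text \<open>The top degrees of the nonzero elements of \<open>Z M v\<close>. They play the role of the leading monomials in a
Groebner basis: every element of \<open>M v\<close> is congruent modulo \<open>Z M v\<close> to exactly one normal form,
that is, to an element without a term in one of these degrees. The space \<open>G v\<close> of normal forms is a
complement of \<open>Z M v\<close> in \<open>M v\<close> which moreover generates \<open>M v\<close>, since reduction lowers degrees.\<close>
definition tops :: "'v \<Rightarrow> nat set" where
  "tops v = {degree m + n | m. m \<in> M v \<and> m \<noteq> 0}"

definition G :: "'v \<Rightarrow> 'k poly set" where
  "G v = {g \<in> M v. \<forall>d\<in>tops v. coeff g d = 0}"

lemma lin_F: "v \<in> S \<Longrightarrow> poly_linear (F v)"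
  using periodic unfolding periodic_map_def by blast

lemma F_shift: "v \<in> S \<Longrightarrow> F v (Z * p) = Z * F v p"
  using periodic periodic_map.shift by blast

lemma M_closed:
  assumes "v \<in> S" "p \<in> M v" "q \<in> M v"
  shows "p + q \<in> M v" "p - q \<in> M v" "smult a p \<in> M v" "Z * p \<in> M v" "0 \<in> M v"
  using assms poly_linear.add[OF lin_F] poly_linear.diff[OF lin_F] poly_linear.smult[OF lin_F]
    F_shift poly_linear.zero[OF lin_F] by (auto simp: M_def)

lemma F_in_M: "v \<in> S \<Longrightarrow> F v q \<in> M v"
  by (simp add: M_def orth)

lemma coeff_Z_mult: "coeff (Z * p) k = (if k < n then 0 else coeff p (k - n))"
  by (simp add: coeff_monom_mult)

text \<open>The usual reduction, from high degrees to low ones. The bound on the degree of \<open>m'\<close> is what makes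
the normal forms generate \<open>M v\<close> over \<open>k[X\<^sup>n]\<close>.\<close>
lemma reduce:
  assumes v: "v \<in> S" and m: "m \<in> M v" and "\<And>d. d \<in> tops v \<Longrightarrow> d \<ge> K \<Longrightarrow> coeff m d = 0"
  shows "\<exists>m'\<in>M v. (m' \<noteq> 0 \<longrightarrow> degree m' + n < K) \<and> m - Z * m' \<in> G v"
  using m assms(3)
proof (induction K arbitrary: m)
  case 0
  then have "m - Z * 0 \<in> G v" by (simp add: G_def)
  then show ?case using M_closed(5)[OF v 0(1) 0(1)] by blast
next
  case (Suc K)
  show ?case
  proof (cases "K \<in> tops v")
    case False
    then have "\<And>d. d \<in> tops v \<Longrightarrow> d \<ge> K \<Longrightarrow> coeff m d = 0"
      using Suc.prems(2) by (metis le_antisym not_less_eq_eq)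
    from Suc.IH[OF Suc.prems(1) this] show ?thesis using less_SucI by blast
  next
    case True
    then obtain a where a: "a \<in> M v" "a \<noteq> 0" "degree a + n = K" by (auto simp: tops_def)
    define c where "c = coeff m K / lead_coeff a"
    define m1 where "m1 = m - Z * smult c a"
    have m1M: "m1 \<in> M v"
      unfolding m1_def using Suc.prems(1) a(1) v M_closed by meson
    have "coeff (Z * smult c a) d = 0" if "d > K" for d
      using that a(3) by (simp add: coeff_monom_mult coeff_eq_0)
    moreover have "coeff (Z * smult c a) K = coeff m K"
      using a by (simp add: coeff_monom_mult c_def flip: a(3))
    ultimately have "\<And>d. d \<in> tops v \<Longrightarrow> d \<ge> K \<Longrightarrow> coeff m1 d = 0"
      using Suc.prems(2) unfolding m1_def
      by (metis coeff_diff diff_self eq_iff_diff_eq_0 le_eq_less_or_eq Suc_leI)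
    from Suc.IH[OF m1M this] obtain m1' where m1': "m1' \<in> M v"
      "m1' \<noteq> 0 \<longrightarrow> degree m1' + n < K" "m1 - Z * m1' \<in> G v" by blast
    have "degree (m1' + smult c a) + n < Suc K" if "m1' + smult c a \<noteq> 0"
    proof -
      have "degree m1' \<le> K - n"
        using m1'(2) by (cases "m1' = 0") auto
      moreover have "degree (smult c a) \<le> K - n"
        using a(3) degree_smult_le[of c a] by simp
      ultimately have "degree (m1' + smult c a) \<le> K - n" by (rule degree_add_le)
      then show ?thesis using a(3) by simp
    qed
    moreover have "m1' + smult c a \<in> M v" using m1'(1) a(1) v M_closed by meson
    moreover have "m - Z * (m1' + smult c a) \<in> G v"
      using m1'(3) by (simp add: m1_def algebra_simps)
    ultimately show ?thesis by blast
  qed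
qed

lemma normal_form:
  assumes v: "v \<in> S" and m: "m \<in> M v"
  obtains g m' where "g \<in> G v" "m' \<in> M v" "m = g + Z * m'" "m' = 0 \<or> degree m' < degree m"
proof -
  obtain m' where m': "m' \<in> M v" "m' \<noteq> 0 \<longrightarrow> degree m' + n < Suc (degree m)" "m - Z * m' \<in> G v"
    using reduce[OF v m, of "Suc (degree m)"] by (auto simp: coeff_eq_0)
  show ?thesis
    by (rule that[OF m'(3,1)]) (use m'(2) n_pos in auto)
qed

text \<open>A nonzero element of \<open>Z M v\<close> has its top degree in \<open>tops v\<close>, so it is not a normal form.\<close>
lemma G_inter_ZM:
  assumes "v \<in> S" "Z * m \<in> G v" "m \<in> M v"
  shows "m = 0"
proof (rule ccontr)
  assume "m \<noteq> 0"
  then have "degree m + n \<in> tops v" using assms by (auto simp: tops_def)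
  then have "coeff (Z * m) (degree m + n) = 0" using assms by (auto simp: G_def)
  then show False using \<open>m \<noteq> 0\<close> by (simp add: coeff_monom_mult)
qed

lemma G_closed:
  assumes "v \<in> S" "p \<in> G v" "q \<in> G v"
  shows "p - q \<in> G v" "smult a p \<in> G v" "p + q \<in> G v" "0 \<in> G v"
  using assms M_closed by (auto simp: G_def)

text \<open>The normal form of \<open>F (lab i) X\<^sup>i\<close>. For \<open>i < n\<close> these are the generators of the summands,
normalized so that \<open>g i\<close> has the lowest term \<open>X\<^sup>i\<close>: the lowest term is unchanged modulo \<open>X\<^sup>n\<close>.\<close>
definition g :: "nat \<Rightarrow> 'k poly" where
  "g i = (SOME x. x \<in> G (lab i) \<and> (\<exists>m\<in>M (lab i). F (lab i) (monom 1 i) = x + Z * m))"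

lemma g:
  "g i \<in> G (lab i)" "\<exists>m\<in>M (lab i). F (lab i) (monom 1 i) = g i + Z * m"
proof -
  have "\<exists>x. x \<in> G (lab i) \<and> (\<exists>m\<in>M (lab i). F (lab i) (monom 1 i) = x + Z * m)"
    using normal_form[OF lab_in F_in_M[OF lab_in]] by metis
  from someI_ex[OF this]
  show "g i \<in> G (lab i)" "\<exists>m\<in>M (lab i). F (lab i) (monom 1 i) = g i + Z * m"
    unfolding g_def by blast+
qed

text \<open>The map over \<open>k[X\<^sup>n]\<close> that sends \<open>X\<^sup>i\<close> to \<open>g i\<close> for all \<open>i < n\<close>.\<close>
definition U :: "'k poly \<Rightarrow> 'k poly" where
  "U = lin_ext (\<lambda>j. monom 1 (n * (j div n)) * g (j mod n))"

lemma lin_U: "poly_linear U"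
  unfolding U_def by (rule poly_linear_lin_ext)

lemma U_monom: "U (monom 1 j) = monom 1 (n * (j div n)) * g (j mod n)"
  by (simp add: U_def lin_ext_monom)

lemma periodic_U: "periodic_map U n"
proof -
  have lin1: "poly_linear (\<lambda>p. U (Z * p))" and lin2: "poly_linear (\<lambda>p. Z * U p)"
    by (unfold_locales; simp add: distrib_left poly_linear.add[OF lin_U] poly_linear.smult[OF lin_U])+
  have "(\<lambda>p. U (Z * p)) = (\<lambda>p. Z * U p)"
    by (rule poly_linear_eqI[OF lin1 lin2])
      (use n_pos in \<open>simp add: mult_monom U_monom mult.assoc[symmetric] algebra_simps\<close>)
  then have "U (Z * p) = Z * U p" for p by meson
  then show ?thesis
    by (simp add: periodic_map_def periodic_map_axioms_def lin_U)
qed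

lemma lab_mod: "lab (j mod n) = lab j"
proof -
  have "lab (i + n * k) = lab i" for i k
    by (induction k) (simp_all add: lab_period add.assoc[symmetric] add.commute[of n])
  then show ?thesis by (metis mod_mult_div_eq)
qed

lemma lower_U: "lower_coeffs U (\<lambda>_. 1)"
  unfolding lower_coeffs_def
proof (intro allI impI)
  fix j k :: nat assume "k \<le> j"
  define i where "i = j mod n"
  have i: "i < n" "j = n * (j div n) + i" using n_pos by (simp_all add: i_def)
  obtain m where m: "F (lab i) (monom 1 i) = g i + Z * m" using g(2) by blast
  have *: "coeff (g i) l = (if l = i then 1 else 0)" if "l \<le> i" for l
  proof -
    have "coeff (g i) l = coeff (F (lab i) (monom 1 i)) l"
      using m that i by (simp add: coeff_Z_mult)
    then show ?thesis
      using diag[OF lab_in, of i] that unfolding lower_coeffs_def by auto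
  qed
  show "coeff (U (monom 1 j)) k = (if k = j then 1 else 0)"
    using \<open>k \<le> j\<close> i *[of "k - n * (j div n)"] unfolding U_monom i_def[symmetric]
    by (auto simp: coeff_monom_mult)
qed

lemma U_monom_in_M: "U (monom 1 j) \<in> M (lab j)"
proof -
  have "monom 1 (n * k) * m \<in> M v" if "m \<in> M v" "v \<in> S" for k m v
  proof (induction k)
    case (Suc k)
    have "monom 1 (n * Suc k) * m = Z * (monom 1 (n * k) * m)"
      by (simp add: mult.assoc[symmetric] mult_monom)
    then show ?case by (simp only: M_closed(4)[OF that(2) Suc Suc])
  qed (use that in simp)
  then show ?thesis
    unfolding U_monom using g(1)[of "j mod n"] lab_in by (simp add: G_def lab_mod)
qed

lemma F_U: "v \<in> S \<Longrightarrow> F v (U (monom 1 j)) = (if lab j = v then U (monom 1 j) else 0)"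
  using U_monom_in_M[of j] orth[of v "lab j" "U (monom 1 j)"] lab_in[of j] by (auto simp: M_def)

text \<open>Modulo \<open>Z M v\<close> the \<open>F v X\<^sup>i\<close> with \<open>i < n\<close> and label \<open>v\<close> span \<open>M v\<close>. The lowest term of an
element \<open>q = F v q\<close> sits at a position with label \<open>v\<close>, so it can be cancelled by a multiple of some
\<open>F v X\<^sup>i\<close>; once the order has reached \<open>n\<close>, the polynomial is divisible by \<open>Z\<close>, and the quotient
is fixed by \<open>F v\<close> as well.\<close>
lemma mod_ZM:
  assumes v: "v \<in> S" and "q \<in> M v" "k \<le> n" "\<And>i. i < k \<Longrightarrow> coeff q i = 0"
  shows "\<exists>c. \<exists>m\<in>M v. q - (\<Sum>i | i < n \<and> lab i = v. smult (c i) (F v (monom 1 i))) = Z * m"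
  using assms(2-)
proof (induction "n - k" arbitrary: k q)
  case 0
  then have "k = n" by simp
  have "coeff q i = coeff (Z * poly_shift n q) i" for i
    using 0(4)[of i] \<open>k = n\<close> by (simp add: coeff_Z_mult coeff_poly_shift)
  then have q: "q = Z * poly_shift n q" by (rule poly_eqI)
  have "Z * F v (poly_shift n q) = Z * poly_shift n q"
    using 0(2) q F_shift[OF v, of "poly_shift n q"] by (simp add: M_def)
  then have "F v (poly_shift n q) = poly_shift n q"
    by (simp add: monom_eq_0_iff)
  then have "poly_shift n q \<in> M v" by (simp add: M_def)
  then show ?case using q by (intro exI[of _ "\<lambda>_. 0"] bexI[of _ "poly_shift n q"]) simp_all
next
  case (Suc l)
  have k: "k < n" using Suc.hyps(2) by linarith
  let ?I = "{i. i < n \<and> lab i = v}"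
  have Fq: "F v q = q" using Suc.prems(1) by (simp add: M_def)
  define a where "a = coeff q k"
  have a0: "a = 0" if "lab k \<noteq> v"
    using lower_coeffsD(2)[OF lin_F[OF v] diag[OF v] Suc.prems(3), of k] that Fq by (simp add: a_def)
  define q' where "q' = q - smult a (F v (monom 1 k))"
  have q'M: "q' \<in> M v"
    unfolding q'_def using v Suc.prems(1) F_in_M M_closed by meson
  have "coeff q' i = 0" if "i < Suc k" for i
    using that Suc.prems(3)[of i] diag[OF v] a0
    by (cases "i = k") (auto simp: q'_def lower_coeffs_def a_def)
  have "l = n - Suc k" using Suc.hyps(2) by linarith
  from Suc.hyps(1)[OF this q'M _ \<open>\<And>i. i < Suc k \<Longrightarrow> coeff q' i = 0\<close>] k
  obtain c m where cm: "m \<in> M v" "q' - (\<Sum>i\<in>?I. smult (c i) (F v (monom 1 i))) = Z * m"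
    by (metis Suc_leI)
  have "(\<Sum>i\<in>?I. smult (if i = k then a else 0) (F v (monom 1 i)))
      = (\<Sum>i\<in>?I. if i = k then smult a (F v (monom 1 k)) else 0)"
    by (rule sum.cong) auto
  also have "\<dots> = smult a (F v (monom 1 k))"
    using k a0 by (auto simp: sum.delta)
  finally have "q - (\<Sum>i\<in>?I. smult (c i + (if i = k then a else 0)) (F v (monom 1 i))) = Z * m"
    using cm(2) by (simp add: q'_def smult_add_left sum.distrib algebra_simps)
  then show ?case using cm(1)
    by (intro exI[of _ "\<lambda>i. c i + (if i = k then a else 0)"] bexI[of _ m])
qed

text \<open>A normal form \<open>q\<close> and the corresponding combination of the \<open>g i\<close> are congruent modulo \<open>Z M v\<close>, and
both are normal forms, so they are equal.\<close>
lemma G_in_range: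
  assumes v: "v \<in> S" and q: "q \<in> G v"
  shows "q \<in> range U"
proof -
  let ?I = "{i. i < n \<and> lab i = v}"
  have qM: "q \<in> M v" using q by (simp add: G_def)
  obtain c m where cm: "m \<in> M v" "q - (\<Sum>i\<in>?I. smult (c i) (F v (monom 1 i))) = Z * m"
    using mod_ZM[OF v qM, of 0] by auto
  have "\<forall>i\<in>?I. \<exists>r\<in>M v. F v (monom 1 i) = g i + Z * r" using g(2) by blast
  then obtain r where r: "\<And>i. i \<in> ?I \<Longrightarrow> r i \<in> M v"
    "\<And>i. i \<in> ?I \<Longrightarrow> F v (monom 1 i) = g i + Z * r i" by metis
  let ?s = "\<Sum>i\<in>?I. smult (c i) (g i)"
  have sumM: "(\<Sum>i\<in>J. smult (c i) (r i)) \<in> M v" if "J \<subseteq> ?I" for J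
  proof -
    have "finite J" by (rule finite_subset[OF that]) simp
    then show ?thesis using that
    proof (induction J rule: finite_induct)
      case empty
      then show ?case using M_closed(5)[OF v qM qM] by simp
    next
      case (insert x J)
      then have "smult (c x) (r x) \<in> M v" "(\<Sum>i\<in>J. smult (c i) (r i)) \<in> M v"
        using M_closed(3)[OF v r(1) qM] by blast+
      then show ?case using M_closed(1)[OF v] insert.hyps by simp
    qed
  qed
  have sumG: "(\<Sum>i\<in>J. smult (c i) (g i)) \<in> G v" if "J \<subseteq> ?I" for J
  proof -
    have "finite J" by (rule finite_subset[OF that]) simp
    then show ?thesis using that
    proof (induction J rule: finite_induct)
      case empty then show ?case using G_closed(4)[OF v q q] by simp
    next
      case (insert x J)
      then have "smult (c x) (g x) \<in> G v" "(\<Sum>i\<in>J. smult (c i) (g i)) \<in> G v"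
        using G_closed(2)[OF v _ q, of "g x"] g(1)[of x] by auto
      then show ?case using G_closed(3)[OF v] insert.hyps by simp
    qed
  qed
  have "(\<Sum>i\<in>?I. smult (c i) (F v (monom 1 i))) = (\<Sum>i\<in>?I. smult (c i) (g i) + Z * smult (c i) (r i))"
    by (rule sum.cong) (simp_all add: r(2) smult_add_right)
  also have "\<dots> = ?s + Z * (\<Sum>i\<in>?I. smult (c i) (r i))"
    by (simp add: sum.distrib sum_distrib_left)
  finally have eq: "q - ?s = Z * (m + (\<Sum>i\<in>?I. smult (c i) (r i)))"
    using cm(2) by (simp add: algebra_simps)
  have "q - ?s \<in> G v" using G_closed(1)[OF v q sumG] by simp
  moreover have "m + (\<Sum>i\<in>?I. smult (c i) (r i)) \<in> M v"
    using M_closed(1)[OF v cm(1) sumM] by simp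
  ultimately have "m + (\<Sum>i\<in>?I. smult (c i) (r i)) = 0"
    unfolding eq by (rule G_inter_ZM[OF v])
  with eq have "q = ?s" by simp
  also have "\<dots> = U (\<Sum>i\<in>?I. smult (c i) (monom 1 i))"
    unfolding poly_linear.sum[OF lin_U] poly_linear.smult[OF lin_U] U_monom
    by (rule sum.cong) auto
  finally show ?thesis by blast
qed

lemma M_in_range:
  assumes v: "v \<in> S" and q: "q \<in> M v"
  shows "q \<in> range U"
  using q
proof (induction "degree q" arbitrary: q rule: less_induct)
  case less
  obtain g' m' where *: "g' \<in> G v" "m' \<in> M v" "q = g' + Z * m'" "m' = 0 \<or> degree m' < degree q"
    using normal_form[OF v less.prems] .
  have "m' \<in> range U"
    using *(4) less.hyps[OF _ *(2)] poly_linear.zero[OF lin_U] by (metis rangeI)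
  then obtain a where a: "m' = U a" by blast
  obtain b where "g' = U b" using G_in_range[OF v *(1)] by blast
  then have "q = U (b + Z * a)"
    using * a periodic_map.shift[OF periodic_U] by (simp add: poly_linear.add[OF lin_U])
  then show ?case by blast
qed

text \<open>Injectivity costs nothing, as \<open>U\<close> preserves lowest terms. This is why neither ranks nor the
independence of the generators have to be discussed.\<close>
lemma inj_U: "inj U"
proof (rule injI, rule ccontr)
  fix p q assume eq: "U p = U q" and ne: "p \<noteq> q"
  define d where "d = p - q"
  have "d \<noteq> 0" "U d = 0" using eq ne poly_linear.diff[OF lin_U] by (auto simp: d_def)
  then have ex: "\<exists>k. coeff d k \<noteq> 0" by (metis leading_coeff_0_iff)
  define k where "k = (LEAST k. coeff d k \<noteq> 0)"
  have "coeff d k \<noteq> 0" "\<And>i. i < k \<Longrightarrow> coeff d i = 0"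
    using LeastI_ex[OF ex] not_less_Least unfolding k_def by blast+
  then show False using lower_coeffsD(2)[OF lin_U lower_U, of k d] \<open>U d = 0\<close> by simp
qed

lemma surj_U: "surj U"
proof -
  have "p \<in> range U" for p
  proof -
    have "\<forall>v\<in>S. \<exists>a. F v p = U a" using M_in_range F_in_M by blast
    then obtain a where "\<And>v. v \<in> S \<Longrightarrow> F v p = U (a v)" by metis
    then have "p = U (\<Sum>v\<in>S. a v)"
      using total[of p] by (simp add: poly_linear.sum[OF lin_U])
    then show ?thesis by blast
  qed
  then show ?thesis by blast
qed

theorem simultaneous_conjugation:
  obtains U W where "periodic_map U n" "periodic_map W n"
    "lower_coeffs U (\<lambda>_. 1)" "lower_coeffs W (\<lambda>_. 1)"
    "\<And>p. U (W p) = p" "\<And>p. W (U p) = p"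
    "\<And>v j. v \<in> S \<Longrightarrow> F v (U (monom 1 j)) = (if lab j = v then U (monom 1 j) else 0)"
proof -
  define W where "W = inv_into UNIV U"
  have UW: "U (W p) = p" and WU: "W (U p) = p" for p
    by (simp_all add: W_def inj_U surj_U surj_f_inv_f)
  have WI: "W p = q" if "U q = p" for p q using WU that by blast
  have lin_W: "poly_linear W"
    by unfold_locales (rule WI, simp add: poly_linear.add[OF lin_U] poly_linear.smult[OF lin_U] UW)+
  have per: "periodic_map W n"
    using lin_W periodic_map.shift[OF periodic_U]
    by (auto simp: periodic_map_def periodic_map_axioms_def UW intro!: WI)
  have "lower_coeffs W (\<lambda>_. 1)"
    unfolding lower_coeffs_def
  proof (intro allI impI)
    fix j k :: nat assume "k \<le> j"
    let ?q = "W (monom 1 j)"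
    have Uq: "U ?q = monom 1 j" by (rule UW)
    show "coeff ?q k = (if k = j then 1 else 0)"
      using \<open>k \<le> j\<close>
    proof (induction k rule: less_induct)
      case (less k)
      then have "coeff ?q i = 0" if "i < k" for i using less.IH[OF that] that less.prems by simp
      from lower_coeffsD(2)[OF lin_U lower_U this] have "coeff ?q k = coeff (monom 1 j) k"
        unfolding Uq by simp
      then show ?case by simp
    qed
  qed
  from that[OF periodic_U per lower_U this UW WU F_U] show ?thesis .
qed

end

section \<open>The product of paths\<close>

abbreviation lookup :: "('a \<Rightarrow>\<^sub>0 'b::zero) \<Rightarrow> 'a \<Rightarrow> 'b" where
  "lookup \<equiv> Poly_Mapping.lookup"

abbreviation keys :: "('a \<Rightarrow>\<^sub>0 'b::zero) \<Rightarrow> 'a set" where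
  "keys \<equiv> Poly_Mapping.keys"

definition path_take :: "nat \<Rightarrow> ('v, 'e) qpath \<Rightarrow> ('v, 'e) qpath" where
  "path_take i p = (fst p, take i (snd p))"

definition path_drop :: "('v, 'e) pre_digraph \<Rightarrow> nat \<Rightarrow> ('v, 'e) qpath \<Rightarrow> ('v, 'e) qpath" where
  "path_drop Q i p = (path_target Q (path_take i p), drop i (snd p))"

lemma path_target_conv: "path_target Q (v, xs) = (if xs = [] then v else head Q (last xs))"
  by (simp add: path_target_def pre_digraph.awalk_verts_conv)

lemma lookup_smult: "lookup (Poly_Mapping.map ((*) (c::'k::field)) f) p = c * lookup f p"
  by (simp add: Poly_Mapping.map.rep_eq when_def)

lemma path_take_simps [simp]:
  "fst (path_take i p) = fst p" "snd (path_take i p) = take i (snd p)" "snd (path_drop Q i p) = drop i (snd p)"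
  "path_take 0 p = (fst p, [])" "path_drop Q 0 p = p" "length (snd p) \<le> i \<Longrightarrow> path_take i p = p"
  by (auto simp: path_take_def path_drop_def path_target_conv prod_eq_iff)

lemma path_drop_length: "path_drop Q (length (snd p)) p = (path_target Q p, [])"
  by (simp add: path_drop_def)

lemma path_take_take: "j \<le> i \<Longrightarrow> path_take j (path_take i p) = path_take j p"
  by (simp add: path_take_def min_def)

lemma path_drop_take: "j \<le> i \<Longrightarrow> path_drop Q j (path_take i p) = path_take (i - j) (path_drop Q j p)"
  by (simp add: path_drop_def path_take_def min_def drop_take)

lemma target_path_drop: "i \<le> length (snd p) \<Longrightarrow> path_target Q (path_drop Q i p) = path_target Q p"
  by (cases p) (auto simp: path_drop_def path_take_def path_target_conv)

lemma path_drop_drop: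
  assumes "j \<le> i" "i \<le> length (snd p)"
  shows "path_drop Q (i - j) (path_drop Q j p) = path_drop Q i p"
proof -
  have "path_target Q (path_take (i - j) (path_drop Q j p)) = path_target Q (path_take i p)"
    using assms target_path_drop[of j "path_take i p" Q] by (simp add: path_drop_take)
  then show ?thesis using assms by (simp add: path_drop_def)
qed

text \<open>A path has exactly one decomposition into two factors for each length of the first factor. So the
coefficients of a product are given by a convolution, from which all laws of multiplication follow.\<close>
lemma lookup_path_mult:
  fixes Q :: "('v, 'e) pre_digraph" and f g :: "('v, 'e) qpath \<Rightarrow>\<^sub>0 'k::field"
  shows "lookup (path_mult Q f g) p =
    (\<Sum>i\<le>length (snd p). lookup f (path_take i p) * lookup g (path_drop Q i p))"
proof -
  define S where "S = {(q, r). path_target Q q = fst r \<and> (fst q, snd q @ snd r) = p}"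
  let ?t = "\<lambda>x. lookup f (fst x) * lookup g (snd x)"
  have sub: "(q, r) \<in> (\<lambda>i. (path_take i p, path_drop Q i p)) ` {..length (snd p)}"
    if "(q, r) \<in> S" for q r
  proof -
    have "fst p = fst q" "snd p = snd q @ snd r" "fst r = path_target Q q"
      using that by (auto simp: S_def)
    then have "(q, r) = (path_take (length (snd q)) p, path_drop Q (length (snd q)) p)"
      "length (snd q) \<le> length (snd p)"
      by (simp_all add: path_take_def path_drop_def prod_eq_iff)
    then show ?thesis by blast
  qed
  have sup: "(path_take i p, path_drop Q i p) \<in> S" for i
    by (simp add: S_def path_drop_def)
  have S: "S = (\<lambda>i. (path_take i p, path_drop Q i p)) ` {..length (snd p)}"
  proof (rule Set.set_eqI)
    fix x :: "('v, 'e) qpath \<times> ('v, 'e) qpath"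
    obtain q r where "x = (q, r)" by (rule prod.exhaust)
    then show "x \<in> S \<longleftrightarrow> x \<in> (\<lambda>i. (path_take i p, path_drop Q i p)) ` {..length (snd p)}"
      using sub sup by blast
  qed
  have fin: "finite S" by (simp add: S)
  have inj: "inj_on (\<lambda>i. (path_take i p, path_drop Q i p)) {..length (snd p)}"
  proof (rule inj_onI)
    fix i j assume "i \<in> {..length (snd p)}" "j \<in> {..length (snd p)}"
      and "(path_take i p, path_drop Q i p) = (path_take j p, path_drop Q j p)"
    then have "length (snd (path_take i p)) = length (snd (path_take j p))" by simp
    then show "i = j" using \<open>i \<in> _\<close> \<open>j \<in> _\<close> by simp
  qed
  have "lookup (path_mult Q f g) p =
      (\<Sum>x\<in>keys f \<times> keys g. if x \<in> S then ?t x else 0)"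
    unfolding path_mult_def lookup_sum sum.cartesian_product
    by (rule sum.cong) (auto simp: S_def lookup_single when_def split: if_splits)
  also have "\<dots> = sum ?t (keys f \<times> keys g \<inter> S)"
    by (rule sum.inter_restrict[symmetric]) simp
  also have "\<dots> = sum ?t S"
    by (rule sum.mono_neutral_left) (auto simp: fin in_keys_iff)
  also have "\<dots> = (\<Sum>i\<le>length (snd p). lookup f (path_take i p) * lookup g (path_drop Q i p))"
    unfolding S sum.reindex[OF inj] by simp
  finally show ?thesis .
qed

lemma path_mult_assoc:
  fixes Q :: "('v, 'e) pre_digraph" and f g h :: "('v, 'e) qpath \<Rightarrow>\<^sub>0 'k::field"
  shows "path_mult Q (path_mult Q f g) h = path_mult Q f (path_mult Q g h)"
proof (rule poly_mapping_eqI)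
  fix p :: "('v, 'e) qpath"
  let ?n = "length (snd p)"
  let ?t = "\<lambda>j i. lookup f (path_take j p) * lookup g (path_take (i - j) (path_drop Q j p)) * lookup h (path_drop Q i p)"
  have "lookup (path_mult Q (path_mult Q f g) h) p = (\<Sum>i\<le>?n. \<Sum>j\<le>i. ?t j i)"
    unfolding lookup_path_mult sum_distrib_right
    by (intro sum.cong refl) (simp_all add: path_take_take path_drop_take min_def)
  also have "\<dots> = (\<Sum>i\<in>{..?n}. \<Sum>j\<in>{..?n}. if j \<le> i then ?t j i else 0)"
    by (rule sum.cong[OF refl], rule sum.mono_neutral_cong_left) auto
  also have "\<dots> = (\<Sum>j\<in>{..?n}. \<Sum>i\<in>{..?n}. if j \<le> i then ?t j i else 0)"
    by (rule sum.swap)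
  also have "\<dots> = (\<Sum>j\<le>?n. \<Sum>i\<in>{j..?n}. ?t j i)"
    by (rule sum.cong[OF refl], rule sum.mono_neutral_cong_right) auto
  also have "\<dots> = (\<Sum>j\<le>?n. \<Sum>i\<in>{..?n - j}. ?t j (i + j))"
  proof (rule sum.cong[OF refl])
    fix j assume "j \<in> {..?n}"
    then show "(\<Sum>i\<in>{j..?n}. ?t j i) = (\<Sum>i\<in>{..?n - j}. ?t j (i + j))"
      by (intro sum.reindex_bij_witness[of _ "\<lambda>i. i + j" "\<lambda>i. i - j"]) auto
  qed
  also have "\<dots> = lookup (path_mult Q f (path_mult Q g h)) p"
    unfolding lookup_path_mult sum_distrib_left
  proof (intro sum.cong refl)
    fix j i assume "j \<in> {..?n}" "i \<in> {..length (snd (path_drop Q j p))}"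
    then have "path_drop Q i (path_drop Q j p) = path_drop Q (i + j) p"
      using path_drop_drop[of j "i + j" p Q] by simp
    then show "?t j (i + j) = lookup f (path_take j p)
        * (lookup g (path_take i (path_drop Q j p)) * lookup h (path_drop Q i (path_drop Q j p)))"
      by simp
  qed simp
  finally show "lookup (path_mult Q (path_mult Q f g) h) p = lookup (path_mult Q f (path_mult Q g h)) p" .
qed

lemma path_mult_add:
  "path_mult Q (f + g) h = path_mult Q f h + path_mult Q g h"
  "path_mult Q f (g + h) = path_mult Q f g + path_mult Q f h"
  by (rule poly_mapping_eqI; simp add: lookup_path_mult lookup_add ring_distribs sum.distrib)+

lemma exists_poly_mapping:
  assumes "finite X"
  shows "\<exists>y. \<forall>p. lookup y p = (if p \<in> X then f p else 0)"
proof -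
  have "finite {p. (if p \<in> X then f p else 0) \<noteq> 0}"
    by (rule finite_subset[OF _ assms]) auto
  then show ?thesis
    by (intro exI[of _ "Abs_poly_mapping (\<lambda>p. if p \<in> X then f p else 0)"]) simp
qed

section \<open>Algebras with a basis of paths\<close>

text \<open>The span of a set \<open>B\<close> of paths that is closed under factors is an algebra: paths outside \<open>B\<close> count as
zero. It is modelled by the finitely supported functions with support in \<open>B\<close>, so that the elements form
a subset \<open>elems\<close> of a type with addition, and only the product has to be truncated. Associativity and
distributivity then hold without conditions on the arguments.\<close>
locale path_basis = fin_digraph Q for Q :: "('v, 'e) pre_digraph" +
  fixes B :: "('v, 'e) qpath set"
  assumes B_paths: "B \<subseteq> paths Q"
    and stationary_in_B: "v \<in> verts Q \<Longrightarrow> stationary v \<in> B"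
    and take_in_B: "p \<in> B \<Longrightarrow> i \<le> length (snd p) \<Longrightarrow> path_take i p \<in> B"
    and drop_in_B: "p \<in> B \<Longrightarrow> i \<le> length (snd p) \<Longrightarrow> path_drop Q i p \<in> B"
begin

definition trunc :: "(('v, 'e) qpath \<Rightarrow>\<^sub>0 'k::field) \<Rightarrow> (('v, 'e) qpath \<Rightarrow>\<^sub>0 'k)" where
  "trunc f = Poly_Mapping.mapp (\<lambda>p c. if p \<in> B then c else 0) f"

definition times :: "(('v, 'e) qpath \<Rightarrow>\<^sub>0 'k::field) \<Rightarrow> (('v, 'e) qpath \<Rightarrow>\<^sub>0 'k) \<Rightarrow> (('v, 'e) qpath \<Rightarrow>\<^sub>0 'k)"
    (infixl \<open>\<star>\<close> 70) where
  "x \<star> y = trunc (path_mult Q x y)"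

definition elems :: "(('v, 'e) qpath \<Rightarrow>\<^sub>0 'k::field) set" where
  "elems = {x. keys x \<subseteq> B}"

definition rad :: "(('v, 'e) qpath \<Rightarrow>\<^sub>0 'k::field) set" where
  "rad = {x \<in> elems. \<forall>v. lookup x (v, []) = 0}"

abbreviation e :: "'v \<Rightarrow> (('v, 'e) qpath \<Rightarrow>\<^sub>0 'k::field)" where
  "e v \<equiv> path_vec (stationary v)"

definition unity :: "(('v, 'e) qpath \<Rightarrow>\<^sub>0 'k::field)" where
  "unity = (\<Sum>v\<in>verts Q. e v)"

lemma lookup_trunc: "lookup (trunc f) p = (if p \<in> B then lookup f p else 0)"
  by (simp add: trunc_def mapp.rep_eq in_keys_iff)

lemma lookup_times: "lookup (x \<star> y) p =
    (if p \<in> B then \<Sum>i\<le>length (snd p). lookup x (path_take i p) * lookup y (path_drop Q i p) else 0)"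
  by (simp add: times_def lookup_trunc lookup_path_mult)

lemma elems_iff: "x \<in> elems \<longleftrightarrow> (\<forall>p. p \<notin> B \<longrightarrow> lookup x p = 0)"
  by (auto simp: elems_def in_keys_iff)

lemma elems_zero: "x \<in> elems \<Longrightarrow> p \<notin> B \<Longrightarrow> lookup x p = 0"
  by (simp add: elems_iff del: split_paired_All)

lemma times_in_elems [simp]: "x \<star> y \<in> elems"
  by (simp add: elems_iff lookup_times)

lemma elems_closed [simp]:
  "x \<in> elems \<Longrightarrow> y \<in> elems \<Longrightarrow> x + y \<in> elems"
  "x \<in> elems \<Longrightarrow> y \<in> elems \<Longrightarrow> x - y \<in> elems"
  "0 \<in> elems"
  by (simp_all add: elems_iff lookup_add lookup_minus)

lemma elems_sum: "(\<And>i. i \<in> X \<Longrightarrow> f i \<in> elems) \<Longrightarrow> sum f X \<in> elems"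
  by (induction X rule: infinite_finite_induct) auto

lemma times_add:
  "(x + y) \<star> z = x \<star> z + y \<star> z" "z \<star> (x + y) = z \<star> x + z \<star> y"
  by (auto intro!: poly_mapping_eqI
      simp: lookup_times lookup_add ring_distribs sum.distrib)

lemma times_minus:
  "(x - y) \<star> z = x \<star> z - y \<star> z" "z \<star> (x - y) = z \<star> x - z \<star> y"
  by (auto intro!: poly_mapping_eqI
      simp: lookup_times lookup_minus ring_distribs sum_subtractf)

lemma times_zero [simp]: "0 \<star> z = 0" "z \<star> 0 = 0"
  by (auto intro!: poly_mapping_eqI simp: lookup_times)

lemma times_sum: "(\<Sum>i\<in>X. f i) \<star> z = (\<Sum>i\<in>X. f i \<star> z)" "z \<star> (\<Sum>i\<in>X. f i) = (\<Sum>i\<in>X. z \<star> f i)"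
  by (induction X rule: infinite_finite_induct) (simp_all add: times_add)

lemma trunc_mult_left: "trunc (path_mult Q (trunc f) g) = trunc (path_mult Q f g)"
  and trunc_mult_right: "trunc (path_mult Q f (trunc g)) = trunc (path_mult Q f g)"
  by (rule poly_mapping_eqI; simp add: lookup_trunc lookup_path_mult take_in_B drop_in_B)+

lemma times_assoc: "(x \<star> y) \<star> z = x \<star> (y \<star> z)"
  by (simp add: times_def trunc_mult_left trunc_mult_right path_mult_assoc)

lemma B_target: "p \<in> B \<Longrightarrow> path_target Q p \<in> verts Q"
  using B_paths by (auto simp: paths_def dest: awlast_in_verts)

lemma B_source: "p \<in> B \<Longrightarrow> fst p \<in> verts Q"
  using B_paths by (auto simp: paths_def awalk_def)

lemma B_hd: "p \<in> B \<Longrightarrow> snd p \<noteq> [] \<Longrightarrow> fst p = tail Q (hd (snd p))"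
  using B_paths by (cases "snd p") (auto simp: paths_def awalk_def)

lemma B_arcs: "p \<in> B \<Longrightarrow> set (snd p) \<subseteq> arcs Q"
  using B_paths by (auto simp: paths_def awalk_def)

lemma stationary_B_iff: "(v, []) \<in> B \<longleftrightarrow> v \<in> verts Q"
  using stationary_in_B[of v] B_source[of "(v, [])"] by (auto simp: stationary_def)

lemma lookup_e: "lookup (e v) p = (if p = (v, []) then 1 else 0)"
  by (auto simp: lookup_single when_def stationary_def)

lemma lookup_e_times: "lookup (e v \<star> x) p = (if p \<in> B \<and> fst p = v then lookup x p else 0)"
proof -
  have "(\<Sum>i\<le>length (snd p). lookup (e v) (path_take i p) * lookup x (path_drop Q i p))
      = (\<Sum>i\<le>length (snd p). if i = 0 then (if fst p = v then lookup x p else 0) else 0)"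
    by (rule sum.cong) (auto simp: lookup_e path_take_def)
  then show ?thesis by (simp add: lookup_times)
qed

lemma lookup_times_e: "lookup (x \<star> e v) p = (if p \<in> B \<and> path_target Q p = v then lookup x p else 0)"
proof -
  have "(\<Sum>i\<le>length (snd p). lookup x (path_take i p) * lookup (e v) (path_drop Q i p))
      = (\<Sum>i\<le>length (snd p). if i = length (snd p) then (if path_target Q p = v then lookup x p else 0) else 0)"
    by (rule sum.cong) (auto simp: lookup_e path_drop_def)
  then show ?thesis by (simp add: lookup_times)
qed

lemma lookup_unity: "lookup unity p = (if snd p = [] \<and> fst p \<in> verts Q then 1 else 0)"
proof -
  have "lookup unity p = (\<Sum>v\<in>verts Q. if v = fst p then (if snd p = [] then 1 else 0) else 0)"
    unfolding unity_def lookup_sum by (rule sum.cong) (auto simp: lookup_e prod_eq_iff)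
  then show ?thesis by (cases "snd p = []") auto
qed

lemma sum_if_conj:
  "finite S \<Longrightarrow> (\<Sum>v\<in>S. if P \<and> a = v then x else 0) = (if P \<and> a \<in> S then x else 0)"
  for x :: "'k::field"
  by (cases P) simp_all

lemma unity_times: "x \<in> elems \<Longrightarrow> unity \<star> x = x"
  by (rule poly_mapping_eqI)
    (simp add: unity_def times_sum lookup_sum lookup_e_times elems_zero sum_if_conj B_source)

lemma times_unity: "x \<in> elems \<Longrightarrow> x \<star> unity = x"
  by (rule poly_mapping_eqI)
    (simp add: unity_def times_sum lookup_sum lookup_times_e elems_zero sum_if_conj B_target)

lemma e_in_elems [simp]: "v \<in> verts Q \<Longrightarrow> e v \<in> elems"
  by (auto simp: elems_iff lookup_e stationary_B_iff)

lemma unity_in_elems [simp]: "unity \<in> elems"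
  unfolding unity_def by (rule elems_sum) simp

lemma e_times_e: "v \<in> verts Q \<Longrightarrow> e v \<star> e w = (if v = w then e v else 0)"
  by (rule poly_mapping_eqI) (auto simp: lookup_e_times lookup_e stationary_B_iff)

end

text \<open>The combinatorial content of the string relations: nonzero paths continue uniquely in both directions.\<close>
locale string_basis = path_basis Q B
  for Q :: "('v, 'e) pre_digraph" and B :: "('v, 'e) qpath set" +
  assumes next_unique: "(tail Q a, [a, b]) \<in> B \<Longrightarrow> (tail Q a, [a, b']) \<in> B \<Longrightarrow> b = b'"
    and prev_unique: "(tail Q b, [b, a]) \<in> B \<Longrightarrow> (tail Q b', [b', a]) \<in> B \<Longrightarrow> b = b'"

context string_basis
begin

section \<open>Systems of idempotents\<close>

definition starts :: "(('v, 'e) qpath \<Rightarrow>\<^sub>0 'k::field) \<Rightarrow> 'e set" where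
  "starts x = {hd (snd p) | p. p \<in> keys x \<and> snd p \<noteq> []}"

definition inverse_pair :: "(('v, 'e) qpath \<Rightarrow>\<^sub>0 'k::field) \<Rightarrow> (('v, 'e) qpath \<Rightarrow>\<^sub>0 'k) \<Rightarrow> bool" where
  "inverse_pair u w \<longleftrightarrow> u \<in> elems \<and> w \<in> elems \<and> u \<star> w = unity \<and> w \<star> u = unity"

text \<open>Complete systems of orthogonal idempotents that agree with the stationary paths modulo the radical.\<close>
definition idem_system :: "('v \<Rightarrow> (('v, 'e) qpath \<Rightarrow>\<^sub>0 'k::field)) \<Rightarrow> bool" where
  "idem_system f \<longleftrightarrow> (\<forall>v\<in>verts Q. f v - e v \<in> rad) \<and>
    (\<forall>v\<in>verts Q. \<forall>w\<in>verts Q. f v \<star> f w = (if v = w then f v else 0)) \<and>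
    (\<Sum>v\<in>verts Q. f v) = unity"

lemma startsI: "p \<in> keys x \<Longrightarrow> snd p \<noteq> [] \<Longrightarrow> hd (snd p) = a \<Longrightarrow> a \<in> starts x"
  unfolding starts_def by blast

lemma startsE:
  assumes "a \<in> starts x"
  obtains p where "p \<in> keys x" "snd p \<noteq> []" "hd (snd p) = a"
  using assms unfolding starts_def by blast

lemma starts_mono: "keys x \<subseteq> keys y \<Longrightarrow> starts x \<subseteq> starts y"
  unfolding starts_def by blast

lemma starts_add: "starts (x + y) \<subseteq> starts x \<union> starts y"
  and starts_minus: "starts (x - y) \<subseteq> starts x \<union> starts y"
proof -
  have "starts z \<subseteq> starts x \<union> starts y" if "keys z \<subseteq> keys x \<union> keys y" for z
    using that unfolding starts_def by blast
  then show "starts (x + y) \<subseteq> starts x \<union> starts y" "starts (x - y) \<subseteq> starts x \<union> starts y"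
    using keys_add[of x y] keys_diff[of x y] by blast+
qed

lemma rad_elems: "x \<in> rad \<Longrightarrow> x \<in> elems"
  by (simp add: rad_def)

lemma rad_closed [simp]:
  "x \<in> rad \<Longrightarrow> y \<in> rad \<Longrightarrow> x + y \<in> rad"
  "x \<in> rad \<Longrightarrow> y \<in> rad \<Longrightarrow> x - y \<in> rad"
  "0 \<in> rad"
  by (simp_all add: rad_def lookup_add lookup_minus)

lemma lookup_times_stationary:
  "lookup (x \<star> y) (v, []) = (if v \<in> verts Q then lookup x (v, []) * lookup y (v, []) else 0)"
  by (simp add: lookup_times stationary_B_iff)

lemma rad_times [simp]: "x \<in> rad \<Longrightarrow> x \<star> y \<in> rad" "y \<in> rad \<Longrightarrow> x \<star> y \<in> rad"
  by (simp_all add: rad_def lookup_times_stationary)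

lemma keys_times:
  assumes "p \<in> keys (x \<star> y)"
  obtains i where "p \<in> B" "i \<le> length (snd p)" "path_take i p \<in> keys x" "path_drop Q i p \<in> keys y"
proof -
  have ne: "lookup (x \<star> y) p \<noteq> 0" using assms by (simp add: in_keys_iff)
  then have "p \<in> B" by (meson lookup_times)
  with ne have "(\<Sum>i\<le>length (snd p). lookup x (path_take i p) * lookup y (path_drop Q i p)) \<noteq> 0"
    by (simp add: lookup_times)
  then obtain i where "i \<in> {..length (snd p)}" "lookup x (path_take i p) * lookup y (path_drop Q i p) \<noteq> 0"
    by (rule sum.not_neutral_contains_not_neutral)
  then show ?thesis using that \<open>p \<in> B\<close> by (simp add: in_keys_iff)
qed

lemma rad_keys: "x \<in> rad \<Longrightarrow> p \<in> keys x \<Longrightarrow> snd p \<noteq> []"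
  by (cases p) (auto simp: rad_def in_keys_iff)

text \<open>A factor from \<open>rad\<close> on the left contributes at least the first arrow. Hence the elements of \<open>rad\<close> whose
paths start in a given set of arrows form a right ideal.\<close>
lemma starts_times:
  assumes "x \<in> rad"
  shows "starts (x \<star> y) \<subseteq> starts x"
proof
  fix a assume "a \<in> starts (x \<star> y)"
  then obtain p where p: "p \<in> keys (x \<star> y)" "hd (snd p) = a" by (rule startsE)
  obtain i where i: "path_take i p \<in> keys x" using keys_times[OF p(1)] .
  have ne: "take i (snd p) \<noteq> []" using rad_keys[OF assms i] by simp
  then have "hd (take i (snd p)) = a" using p(2) by (cases i) (auto simp: hd_take)
  then show "a \<in> starts x" using i ne by (intro startsI[of "path_take i p"]) simp_all
qed

lemma starts_e_times: "starts (e v \<star> x) \<subseteq> starts x"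
  by (rule starts_mono) (auto simp: in_keys_iff lookup_e_times simp del: split_paired_All split: if_splits)

lemma keys_in_B: "x \<in> elems \<Longrightarrow> p \<in> keys x \<Longrightarrow> p \<in> B"
  by (auto simp: elems_def)

lemma two_arrows_in_B:
  assumes "p \<in> B" "Suc i < length (snd p)"
  shows "(tail Q (snd p ! i), [snd p ! i, snd p ! Suc i]) \<in> B"
proof -
  let ?q = "path_take 2 (path_drop Q i p)"
  have snd: "snd ?q = [snd p ! i, snd p ! Suc i]"
    using assms(2) by (simp add: numeral_2_eq_2 take_Suc_conv_app_nth Cons_nth_drop_Suc[symmetric])
  have q: "?q \<in> B" using assms by (intro take_in_B drop_in_B) auto
  then have "fst ?q = tail Q (snd p ! i)" using B_hd[OF q] unfolding snd by simp
  then show ?thesis using q snd by (metis prod.collapse)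
qed

text \<open>Since every arrow has at most one successor, a path in \<open>B\<close> is determined by its first arrow and its length.\<close>
lemma B_unique:
  assumes "p \<in> B" "q \<in> B" "snd p \<noteq> []" "hd (snd p) = hd (snd q)" "length (snd p) = length (snd q)"
  shows "p = q"
proof -
  have ne: "snd q \<noteq> []" using assms by auto
  have "snd p ! i = snd q ! i" if "i < length (snd p)" for i
    using that
  proof (induction i)
    case 0
    then show ?case using assms ne by (simp add: hd_conv_nth)
  next
    case (Suc i)
    then have "snd p ! i = snd q ! i" by simp
    then show ?case
      using two_arrows_in_B[OF assms(1) Suc.prems] two_arrows_in_B[OF assms(2), of i] Suc.prems assms(5)
        next_unique by metis
  qed
  then have "snd p = snd q" using assms(5) by (simp add: list_eq_iff_nth_eq)
  moreover have "fst p = fst q" using B_hd assms ne by metis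
  ultimately show ?thesis by (simp add: prod_eq_iff)
qed

lemma idem_systemD:
  assumes "idem_system f" "v \<in> verts Q"
  shows "f v - e v \<in> rad" "f v \<in> elems" "w \<in> verts Q \<Longrightarrow> f v \<star> f w = (if v = w then f v else 0)"
proof -
  show *: "f v - e v \<in> rad" using assms by (simp add: idem_system_def)
  have "f v = (f v - e v) + e v" by simp
  also have "\<dots> \<in> elems" using rad_elems[OF *] assms(2) by (intro elems_closed(1)) auto
  finally show "f v \<in> elems" .
  show "w \<in> verts Q \<Longrightarrow> f v \<star> f w = (if v = w then f v else 0)"
    using assms by (simp add: idem_system_def)
qed

lemma idem_system_sum: "idem_system f \<Longrightarrow> (\<Sum>v\<in>verts Q. f v) = unity"
  by (simp add: idem_system_def)

lemma idem_system_stationary: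
  assumes "idem_system f" "v \<in> verts Q"
  shows "lookup (f v) (w, []) = (if v = w then 1 else 0)"
proof -
  have "lookup (f v - e v) (w, []) = 0" using idem_systemD(1)[OF assms] by (simp add: rad_def)
  then show ?thesis by (auto simp: lookup_minus lookup_e)
qed

lemma idem_system_conjugate:
  assumes f: "idem_system f" and u: "inverse_pair u w"
    and rad: "\<And>v. v \<in> verts Q \<Longrightarrow> u \<star> f v \<star> w - e v \<in> rad"
  shows "idem_system (\<lambda>v. u \<star> f v \<star> w)"
proof -
  have wu: "w \<star> (u \<star> x) = x" if "x \<in> elems" for x
    using u that by (simp add: inverse_pair_def unity_times times_assoc[symmetric])
  have "(u \<star> f v \<star> w) \<star> (u \<star> f v' \<star> w) = (if v = v' then u \<star> f v \<star> w else 0)"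
    if "v \<in> verts Q" "v' \<in> verts Q" for v v'
  proof -
    have "(u \<star> f v \<star> w) \<star> (u \<star> f v' \<star> w) = u \<star> (f v \<star> f v') \<star> w"
      by (simp add: times_assoc wu)
    then show ?thesis using idem_systemD(3)[OF f that] by simp
  qed
  moreover have "(\<Sum>v\<in>verts Q. u \<star> f v \<star> w) = u \<star> (\<Sum>v\<in>verts Q. f v) \<star> w"
    by (simp add: times_sum)
  then have "(\<Sum>v\<in>verts Q. u \<star> f v \<star> w) = unity"
    using u by (simp add: idem_system_sum[OF f] inverse_pair_def times_unity)
  ultimately show ?thesis using rad by (simp add: idem_system_def)
qed

end

section \<open>The action of a cycle on polynomials\<close>

text \<open>A closed walk through \<open>n\<close> distinct arrows, unrolled to an infinite sequence \<open>c\<close>, around which one can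
go arbitrarily often without leaving \<open>B\<close>. Vertices may repeat within a period.\<close>
locale path_cycle = string_basis Q B for Q :: "('v, 'e) pre_digraph" and B :: "('v, 'e) qpath set" +
  fixes c :: "nat \<Rightarrow> 'e" and n :: nat
  assumes n_pos: "0 < n"
    and c_period: "c (j + n) = c j"
    and c_inj: "i < n \<Longrightarrow> j < n \<Longrightarrow> c i = c j \<Longrightarrow> i = j"
    and seg_in_B: "i \<le> j \<Longrightarrow> (tail Q (c i), map c [i..<j]) \<in> B"
begin

definition seg :: "nat \<Rightarrow> nat \<Rightarrow> ('v, 'e) qpath" where
  "seg i j = (tail Q (c i), map c [i..<j])"

lemma seg_B [simp]: "i \<le> j \<Longrightarrow> seg i j \<in> B"
  by (simp add: seg_def seg_in_B)

lemma fst_snd_seg [simp]: "fst (seg i j) = tail Q (c i)" "snd (seg i j) = map c [i..<j]"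
  by (simp_all add: seg_def)

lemma hd_seg: "i < j \<Longrightarrow> hd (map c [i..<j]) = c i"
  by (simp add: hd_map)

lemma seg_self: "seg j j = (tail Q (c j), [])"
  by (simp add: seg_def)

lemma tail_c_in [simp]: "tail Q (c j) \<in> verts Q"
  using seg_B[of j j] by (simp add: seg_self stationary_B_iff)

lemma head_c: "head Q (c j) = tail Q (c (Suc j))"
proof -
  have "seg j (Suc (Suc j)) \<in> paths Q" using seg_B[of j "Suc (Suc j)"] B_paths by force
  then show ?thesis by (simp add: paths_def seg_def awalk_def upt_conv_Cons)
qed

lemma target_seg: "i \<le> j \<Longrightarrow> path_target Q (seg i j) = tail Q (c j)"
  by (cases j) (auto simp: seg_def path_target_conv head_c le_Suc_eq)

lemma take_seg: "i + k \<le> j \<Longrightarrow> path_take k (seg i j) = seg i (i + k)"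
  by (simp add: path_take_def seg_def take_map)

lemma drop_seg: "i + k \<le> j \<Longrightarrow> path_drop Q k (seg i j) = seg (i + k) j"
  by (simp add: path_drop_def take_seg target_seg) (simp add: seg_def drop_map)

lemma seg_period: "seg (i + n) (j + n) = seg i j"
proof -
  have "c (i + n + k) = c (i + k)" for k
    using c_period[of "i + k"] by (simp add: add.assoc add.commute[of n])
  then have "map c [i + n..<j + n] = map c [i..<j]"
    by (intro nth_equalityI) auto
  then show ?thesis by (simp add: seg_def c_period)
qed

text \<open>A path in \<open>B\<close> that starts on the cycle never leaves it.\<close>
lemma follow:
  assumes "p \<in> B" "snd p \<noteq> []" "hd (snd p) = c j"
  shows "p = seg j (j + length (snd p))"
  by (rule B_unique) (use assms in \<open>simp_all add: hd_seg\<close>)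

lemma lookup_times_seg:
  assumes "i \<le> j"
  shows "lookup (x \<star> y) (seg i j) = (\<Sum>k\<in>{i..j}. lookup x (seg i k) * lookup y (seg k j))"
proof -
  have "lookup (x \<star> y) (seg i j) = (\<Sum>k\<le>j - i. lookup x (seg i (i + k)) * lookup y (seg (i + k) j))"
    using assms by (simp add: lookup_times take_seg drop_seg)
  also have "\<dots> = (\<Sum>k\<in>{i..j}. lookup x (seg i k) * lookup y (seg k j))"
    by (rule sum.reindex_bij_witness[of _ "\<lambda>k. k - i" "\<lambda>k. i + k"]) (use assms in auto)
  finally show ?thesis .
qed

text \<open>The monomial \<open>X\<^sup>j\<close> stands for the \<open>j\<close>-th position on the cycle, and the path from position \<open>j\<close> to
position \<open>m\<close> sends \<open>X\<^sup>j\<close> to \<open>X\<^sup>m\<close>. This is a right action, so products are reversed.\<close>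
definition row :: "(('v, 'e) qpath \<Rightarrow>\<^sub>0 'k::field) \<Rightarrow> nat \<Rightarrow> 'k poly" where
  "row x j = Abs_poly (\<lambda>m. if j \<le> m then lookup x (seg j m) else 0)"

definition act :: "(('v, 'e) qpath \<Rightarrow>\<^sub>0 'k::field) \<Rightarrow> 'k poly \<Rightarrow> 'k poly" where
  "act x = lin_ext (row x)"

lemma coeff_row: "coeff (row x j) m = (if j \<le> m then lookup x (seg j m) else 0)"
proof -
  define N where "N = Max (insert 0 ((\<lambda>p. length (snd p)) ` keys x))"
  have N: "length (snd p) \<le> N" if "p \<in> keys x" for p
    unfolding N_def using that by (intro Max_ge) auto
  have zero: "(if j \<le> m then lookup x (seg j m) else 0) = 0" if "m > N + j" for m
  proof -
    have "seg j m \<notin> keys x" using N[of "seg j m"] that by fastforce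
    then show ?thesis by (simp add: in_keys_iff)
  qed
  then show ?thesis unfolding row_def by (subst coeff_Abs_poly[OF zero]) auto
qed

lemma act_monom: "act x (monom 1 j) = row x j"
  by (simp add: act_def lin_ext_monom)

lemma lookup_seg: "i \<le> j \<Longrightarrow> lookup x (seg i j) = coeff (act x (monom 1 i)) j"
  by (simp add: act_monom coeff_row)

lemma lin_act: "poly_linear (act x)"
  unfolding act_def by (rule poly_linear_lin_ext)

lemma periodic_act: "periodic_map (act x) n"
  unfolding act_def
proof (rule lin_ext_periodic, rule poly_eqI)
  fix j m
  show "coeff (row x (j + n)) m = coeff (monom 1 n * row x j) m"
    using seg_period[of j "m - n"] by (auto simp: coeff_row coeff_monom_mult)
qed

lemma act_times: "act (x \<star> y) = act y \<circ> act x"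
proof (rule poly_linear_eqI[OF lin_act])
  show "poly_linear (act y \<circ> act x)"
    by unfold_locales (simp_all add: poly_linear.add[OF lin_act] poly_linear.smult[OF lin_act])
  fix j
  have "coeff (act y (row x j)) m = coeff (row (x \<star> y) j) m" for m
  proof -
    have "coeff (act y (row x j)) m = (\<Sum>i\<le>m. coeff (row x j) i * coeff (row y i) m)"
      unfolding act_def by (rule coeff_lin_ext) (simp add: coeff_row)
    also have "\<dots> = (\<Sum>i\<in>{j..m}. lookup x (seg j i) * lookup y (seg i m))"
      by (rule sum.mono_neutral_cong_right) (auto simp: coeff_row)
    finally show ?thesis by (simp add: coeff_row lookup_times_seg)
  qed
  then show "act (x \<star> y) (monom 1 j) = (act y \<circ> act x) (monom 1 j)"
    by (simp add: act_monom poly_eq_iff)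
qed

lemma act_add: "act (x + y) p = act x p + act y p"
proof -
  have "row (x + y) j = row x j + row y j" for j
    by (rule poly_eqI) (simp add: coeff_row lookup_add)
  then show ?thesis by (simp add: act_def lin_ext_def smult_add_right sum.distrib)
qed

lemma act_zero: "act 0 (p :: 'k::field poly) = 0"
proof -
  have "row 0 j = (0 :: 'k poly)" for j
    by (rule poly_eqI) (simp add: coeff_row)
  then show ?thesis by (simp add: act_def lin_ext_def)
qed

lemma act_sum: "act (\<Sum>v\<in>X. f v) p = (\<Sum>v\<in>X. act (f v) p)"
  by (induction X rule: infinite_finite_induct) (simp_all add: act_add act_zero)

lemma act_e: "act (e v) (monom 1 j) = (if tail Q (c j) = v then monom 1 j else 0)"
  by (rule poly_eqI) (auto simp: act_monom coeff_row lookup_e seg_def)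

lemma act_unity: "act unity (p :: 'k::field poly) = p"
proof -
  have "poly_linear (\<lambda>p :: 'k poly. p)" by unfold_locales simp_all
  then have "act unity = (\<lambda>p :: 'k poly. p)"
    by (rule poly_linear_eqI[OF lin_act])
      (simp add: unity_def act_sum act_e)
  then show ?thesis by metis
qed

lemma act_lower: "lower_coeffs (act x) (\<lambda>j. lookup x (tail Q (c j), []))"
  by (auto simp: lower_coeffs_def act_monom coeff_row seg_self)

text \<open>The coefficients of an element at the paths on the cycle can be read off from its action.\<close>
lemma act_faithful:
  assumes "x - y \<in> elems" "act x = act y"
  shows "starts (x - y) \<inter> range c = {}"
proof (rule ccontr)
  assume "starts (x - y) \<inter> range c \<noteq> {}"
  then obtain j where "c j \<in> starts (x - y)" by blast
  then obtain p where p: "p \<in> keys (x - y)" "snd p \<noteq> []" "hd (snd p) = c j"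
    by (rule startsE)
  define m where "m = j + length (snd p)"
  have "p = seg j m"
    unfolding m_def using keys_in_B[OF assms(1) p(1)] p(2,3) by (rule follow)
  moreover have "lookup (x - y) (seg j m) = 0"
    by (simp add: lookup_minus lookup_seg assms(2) m_def)
  ultimately show False using p(1) by (simp add: in_keys_iff)
qed

lemma rad_eq_0: "x \<in> rad \<Longrightarrow> starts x = {} \<Longrightarrow> x = 0"
proof -
  assume x: "x \<in> rad" "starts x = {}"
  then have "p \<notin> keys x" for p using rad_keys[of x p] startsI[of p x] by blast
  then have "keys x = {}" by blast
  then show "x = 0" by simp
qed

text \<open>A periodic map is determined by the images of \<open>1, X, \<dots>, X\<^sup>n\<^sup>-\<^sup>1\<close>, that is, by finitely many
coefficients. As the arrows of one period are distinct, these coefficients can be prescribed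
independently of each other on the paths that start in that period.\<close>
lemma realize:
  assumes "periodic_map U n" "lower_coeffs U (\<lambda>_. 1)"
  obtains y where "y \<in> rad" "starts y \<subseteq> range c" "act (unity + y) = U"
proof -
  define X where "X = (\<lambda>(j, m). seg j m) ` (SIGMA j:{..<n}. {j<..degree (U (monom 1 j))})"
  (* the position in the first period at which a path starts *)
  define idx where "idx p = (THE j. j < n \<and> c j = hd (snd p))" for p :: "('v, 'e) qpath"
  have idx: "idx (seg j m) = j" if "j < n" "j < m" for j m
    unfolding idx_def by (rule the_equality) (use that c_inj in \<open>auto simp: hd_seg\<close>)
  have "finite X" unfolding X_def by (intro finite_imageI finite_SigmaI) auto
  then obtain y where y: "\<And>p. lookup y p =
      (if p \<in> X then coeff (U (monom 1 (idx p))) (idx p + length (snd p)) else 0)"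
    using exists_poly_mapping[of X "\<lambda>p. coeff (U (monom 1 (idx p))) (idx p + length (snd p))"] by auto
  have X: "p \<in> B \<and> snd p \<noteq> [] \<and> hd (snd p) \<in> range c" if "p \<in> X" for p
    using that by (auto simp: X_def hd_seg)
  have rad: "y \<in> rad"
  proof -
    have "lookup y p = 0" if "p \<notin> B \<or> snd p = []" for p
      using X[of p] that y[of p] by auto
    then show ?thesis by (simp add: rad_def elems_iff)
  qed
  have starts: "starts y \<subseteq> range c"
  proof
    fix a assume "a \<in> starts y"
    then obtain p where p: "p \<in> keys y" "hd (snd p) = a" by (rule startsE)
    then have "p \<in> X" using y[of p] by (metis in_keys_iff)
    then show "a \<in> range c" using X p(2) by blast
  qed
  have "act (unity + y) = U"
  proof (rule periodic_map_eqI[OF periodic_act assms(1) _ n_pos], rule poly_eqI)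
    fix j m assume j: "j < n"
    consider "m < j" | "m = j" | "j < m" by linarith
    then show "coeff (act (unity + y) (monom 1 j)) m = coeff (U (monom 1 j)) m"
    proof cases
      case 1
      then show ?thesis using assms(2) by (simp add: act_monom coeff_row lower_coeffs_def)
    next
      case 2
      have "lookup y (seg j j) = 0" using rad by (simp add: seg_self rad_def)
      then show ?thesis using assms(2) 2
        by (simp add: act_monom coeff_row lower_coeffs_def lookup_add lookup_unity)
    next
      case 3
      have "lookup y (seg j m) = coeff (U (monom 1 j)) m"
      proof (cases "m \<le> degree (U (monom 1 j))")
        case True
        then have "seg j m \<in> X" using 3 j by (force simp: X_def)
        then show ?thesis using 3 by (simp add: y idx j)
      next
        case False
        then show ?thesis using 3 by (auto simp: y idx j coeff_eq_0)
      qed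
      then show ?thesis using 3 by (simp add: act_monom coeff_row lookup_add lookup_unity)
    qed
  qed
  then show ?thesis using that rad starts by blast
qed

lemma inverse_from_act:
  assumes y: "y \<in> rad" "starts y \<subseteq> range c" and z: "z \<in> rad" "starts z \<subseteq> range c"
    and id: "\<And>p. act (unity + z) (act (unity + y) p) = p"
  shows "(unity + y) \<star> (unity + z) = unity"
proof -
  let ?d = "(unity + y) \<star> (unity + z) - unity"
  have d: "?d = z + y + y \<star> z"
    using rad_elems[OF y(1)] rad_elems[OF z(1)] by (simp add: times_add unity_times times_unity)
  have "?d \<in> rad" unfolding d using y z by simp
  moreover have "starts ?d \<subseteq> range c"
    unfolding d using starts_add[of "z + y" "y \<star> z"] starts_add[of z y] starts_times[OF y(1), of z] y z
    by blast
  moreover have "act ((unity + y) \<star> (unity + z)) = act unity"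
    by (rule ext) (simp add: act_times id act_unity)
  then have "starts ?d \<inter> range c = {}"
    using act_faithful rad_elems[OF \<open>?d \<in> rad\<close>] by blast
  ultimately have "?d = 0" using rad_eq_0 by blast
  then show ?thesis by simp
qed

text \<open>The conjugation that is provided by the polynomial model is the action of a unit. Such a unit differs
from \<open>1\<close> only by paths on the cycle, hence it introduces no new starting arrows
elsewhere: the condition \<open>u f v = e v u\<close> is achieved on the cycle and nothing is spoiled off it.\<close>
lemma straighten_cycle:
  assumes f: "idem_system f"
  obtains u w where "inverse_pair u w" "u - unity \<in> rad" "idem_system (\<lambda>v. u \<star> f v \<star> w)"
    "\<And>v. v \<in> verts Q \<Longrightarrow> starts (u \<star> f v \<star> w - e v) \<subseteq> starts (f v - e v) - range c"
proof -
  interpret periodic_idempotents n "verts Q" "\<lambda>v. act (f v)" "\<lambda>j. tail Q (c j)"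
  proof
    fix v w p assume v: "v \<in> verts Q" and w: "w \<in> verts Q"
    have "act (f v) (act (f w) p) = act (f w \<star> f v) p" by (simp add: act_times)
    then show "act (f v) (act (f w) p) = (if v = w then act (f v) p else 0)"
      using idem_systemD(3)[OF f w v] by (simp add: act_zero)
  next
    fix p show "(\<Sum>v\<in>verts Q. act (f v) p) = p"
      by (simp add: act_sum[symmetric] idem_system_sum[OF f] act_unity)
  next
    fix v assume "v \<in> verts Q"
    then show "lower_coeffs (act (f v)) (\<lambda>j. if tail Q (c j) = v then 1 else 0)"
      using act_lower[of "f v"] by (simp add: idem_system_stationary[OF f] eq_commute[of v])
  qed (simp_all add: n_pos c_period poly_linear.add[OF lin_act] poly_linear.smult[OF lin_act]
      periodic_map.shift[OF periodic_act])
  obtain U W where U: "periodic_map U n" "lower_coeffs U (\<lambda>_. 1)"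
    and W: "periodic_map W n" "lower_coeffs W (\<lambda>_. 1)"
    and UW: "\<And>p. U (W p) = p" "\<And>p. W (U p) = p"
    and conj: "\<And>v j. v \<in> verts Q \<Longrightarrow>
      act (f v) (U (monom 1 j)) = (if tail Q (c j) = v then U (monom 1 j) else 0)"
    by (rule simultaneous_conjugation) blast
  obtain y where y: "y \<in> rad" "starts y \<subseteq> range c" "act (unity + y) = U"
    using realize[OF U] .
  obtain z where z: "z \<in> rad" "starts z \<subseteq> range c" "act (unity + z) = W"
    using realize[OF W] .
  let ?u = "unity + y" and ?w = "unity + z"
  have el: "?u \<in> elems" "?w \<in> elems" using rad_elems[OF y(1)] rad_elems[OF z(1)] by simp_all
  have inv: "inverse_pair ?u ?w"
    using inverse_from_act[OF y(1,2) z(1,2)] inverse_from_act[OF z(1,2) y(1,2)] y(3) z(3) UW el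
    by (simp add: inverse_pair_def)
  have key: "?u \<star> f v \<star> ?w - e v \<in> rad \<and>
      starts (?u \<star> f v \<star> ?w - e v) \<subseteq> starts (f v - e v) - range c" if v: "v \<in> verts Q" for v
  proof -
    let ?x = "?u \<star> f v - e v \<star> ?u"
    have fv: "f v \<in> elems" using idem_systemD(2)[OF f v] .
    have x: "?x = (f v - e v) + y \<star> f v - e v \<star> y"
      using fv v by (simp add: times_add unity_times times_unity)
    have x_rad: "?x \<in> rad" unfolding x using y idem_systemD(1)[OF f v] by simp
    have "act (?u \<star> f v) = act (e v \<star> ?u)"
    proof (rule poly_linear_eqI[OF lin_act lin_act])
      fix j
      show "act (?u \<star> f v) (monom 1 j) = act (e v \<star> ?u) (monom 1 j)"
        using conj[OF v] periodic_map.axioms(1)[OF U(1)]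
        by (simp add: act_times y(3) act_e poly_linear.zero)
    qed
    from act_faithful[OF rad_elems[OF x_rad] this]
    have "starts ?x \<inter> range c = {}" .
    moreover have "starts ?x \<subseteq> starts (f v - e v) \<union> range c"
      unfolding x using starts_minus[of "(f v - e v) + y \<star> f v" "e v \<star> y"]
        starts_add[of "f v - e v" "y \<star> f v"] starts_times[OF y(1), of "f v"] starts_e_times[of v y] y(2)
      by blast
    ultimately have "starts ?x \<subseteq> starts (f v - e v) - range c" by blast
    moreover have "?u \<star> f v \<star> ?w - e v = ?x \<star> ?w"
      using inv v by (simp add: times_minus times_assoc inverse_pair_def times_unity)
    ultimately show ?thesis
      using x_rad starts_times[OF x_rad, of ?w] by auto
  qed
  show ?thesis
    by (rule that[OF inv _ idem_system_conjugate[OF f inv]]) (use key y(1) in auto)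
qed

end

context string_basis
begin

section \<open>Recurrent arrows and the nilpotent ideal\<close>

definition recurrent :: "'e set" where
  "recurrent = {a. \<forall>L. \<exists>p\<in>B. L < length (snd p) \<and> hd (snd p) = a}"

text \<open>The long paths that start with \<open>a\<close> are prefixes of one infinite path. There are finitely many arrows, so
some arrow repeats; as predecessors are unique, the repetition can be moved back to \<open>a\<close> itself. The
first return to \<open>a\<close> is the period.\<close>
lemma cycle_through:
  assumes "a \<in> recurrent"
  obtains c n where "path_cycle Q B c n" "c 0 = a"
proof -
  have "\<forall>L. \<exists>p. p \<in> B \<and> L < length (snd p) \<and> hd (snd p) = a"
    using assms unfolding recurrent_def by blast
  then obtain P where P: "\<And>L. P L \<in> B" "\<And>L. L < length (snd (P L))" "\<And>L. hd (snd (P L)) = a"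
    by metis
  define c where "c i = snd (P i) ! i" for i
  have c: "snd (P L) ! i = c i" if "i \<le> L" for i L
  proof -
    have len: "Suc i \<le> length (snd (P L))" "Suc i \<le> length (snd (P i))"
      using P(2)[of L] P(2)[of i] that by linarith+
    have "path_take (Suc i) (P L) = path_take (Suc i) (P i)"
    proof (rule B_unique)
      show "path_take (Suc i) (P L) \<in> B" "path_take (Suc i) (P i) \<in> B"
        using take_in_B P(1) len by blast+
      show "hd (snd (path_take (Suc i) (P L))) = hd (snd (path_take (Suc i) (P i)))"
        using P(3) len by (simp add: hd_take)
    qed (use len in auto)
    then have "take (Suc i) (snd (P L)) ! i = take (Suc i) (snd (P i)) ! i"
      by (metis path_take_simps(2))
    then show ?thesis by (simp add: c_def)
  qed
  have c_arcs: "c i \<in> arcs Q" for i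
    using B_arcs[OF P(1)] nth_mem[OF P(2)] unfolding c_def by blast
  have seg: "(tail Q (c i), map c [i..<j]) \<in> B" if "i \<le> j" for i j
  proof (cases "i = j")
    case True
    then show ?thesis using c_arcs[of i] by (simp add: stationary_B_iff)
  next
    case False
    let ?q = "path_drop Q i (path_take j (P j))"
    have len: "j < length (snd (P j))" by (rule P(2))
    have q: "?q \<in> B" using len that P(1) by (intro drop_in_B take_in_B) auto
    have snd: "snd ?q = map c [i..<j]"
      by (rule nth_equalityI) (use len that c in auto)
    have "fst ?q = tail Q (c i)"
      using B_hd[OF q] False that unfolding snd by (simp add: hd_map)
    then show ?thesis using q snd by (metis prod.collapse)
  qed
  have two: "(tail Q (c i), [c i, c (Suc i)]) \<in> B" for i
    using seg[of i "Suc (Suc i)"] by (simp add: upt_conv_Cons)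
  have shift: "c k = c 0" if "c (i + k) = c i" for i k
    using that
  proof (induction i)
    case (Suc i)
    have "c (i + k) = c i"
      using two[of "i + k"] two[of i] Suc.prems by (intro prev_unique[of _ "c (Suc i)"]) simp_all
    then show ?case by (rule Suc.IH)
  qed simp
  have "finite (range c)" by (rule finite_subset[of _ "arcs Q"]) (use c_arcs in auto)
  then have "\<not> inj c" using finite_imageD[of c UNIV] by auto
  then obtain i j where ij: "i < j" "c i = c j"
    unfolding inj_def by (metis linorder_neqE_nat)
  then have "\<exists>k. 0 < k \<and> c k = c 0"
    using shift[of i "j - i"] by (intro exI[of _ "j - i"]) auto
  define n where "n = (LEAST k. 0 < k \<and> c k = c 0)"
  have n: "0 < n" "c n = c 0"
    using LeastI_ex[OF \<open>\<exists>k. 0 < k \<and> c k = c 0\<close>] unfolding n_def by blast+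
  have least: "n \<le> k" if "0 < k" "c k = c 0" for k
    unfolding n_def using that by (intro Least_le) blast
  have period: "c (j + n) = c j" for j
  proof (induction j)
    case (Suc j)
    show ?case using two[of j] two[of "j + n"] next_unique Suc.IH by simp
  qed (simp add: n(2))
  have inj: "i = j" if "i \<le> j" "j < n" "c i = c j" for i j
    using shift[of i "j - i"] least[of "j - i"] that by force
  have "path_cycle Q B c n"
  proof
    fix i j assume "i < n" "j < n" "c i = c j"
    then show "i = j" using inj[of i j] inj[of j i] by (cases "i \<le> j") auto
  qed (use n(1) period seg in auto)
  moreover have "c 0 = a" using P(3)[of 0] P(2)[of 0] by (simp add: c_def hd_conv_nth)
  ultimately show ?thesis by (rule that)
qed

lemma (in path_cycle) c_recurrent: "c j \<in> recurrent"
proof -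
  have "\<exists>p\<in>B. L < length (snd p) \<and> hd (snd p) = c j" for L
    by (rule bexI[of _ "seg j (j + Suc L)"]) (simp_all add: hd_seg del: upt_Suc)
  then show ?thesis by (simp add: recurrent_def)
qed

lemma nonrecurrent_bounded:
  obtains L where "\<And>p. p \<in> B \<Longrightarrow> snd p \<noteq> [] \<Longrightarrow> hd (snd p) \<notin> recurrent \<Longrightarrow> length (snd p) \<le> L"
proof -
  have "\<forall>a. \<exists>L. a \<notin> recurrent \<longrightarrow> (\<forall>p\<in>B. hd (snd p) = a \<longrightarrow> length (snd p) \<le> L)"
    unfolding recurrent_def by (auto simp: not_less)
  then obtain L where L: "\<And>a p. a \<notin> recurrent \<Longrightarrow> p \<in> B \<Longrightarrow> hd (snd p) = a \<Longrightarrow> length (snd p) \<le> L a"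
    by metis
  show ?thesis
  proof (rule that)
    fix p assume p: "p \<in> B" "snd p \<noteq> []" "hd (snd p) \<notin> recurrent"
    have "hd (snd p) \<in> arcs Q" using B_arcs[OF p(1)] p(2) by (meson hd_in_set subsetD)
    then have "L (hd (snd p)) \<le> Max (L ` arcs Q)" by (intro Max_ge) auto
    then show "length (snd p) \<le> Max (L ` arcs Q)" using L[OF p(3,1) refl] by linarith
  qed
qed

definition nil :: "(('v, 'e) qpath \<Rightarrow>\<^sub>0 'k::field) set" where
  "nil = {x \<in> rad. starts x \<inter> recurrent = {}}"

lemma nil_closed:
  assumes "x \<in> nil" "y \<in> nil"
  shows "x + y \<in> nil" "x - y \<in> nil" "x \<star> z \<in> nil"
  using assms starts_add[of x y] starts_minus[of x y] starts_times[of x z]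
  by (auto simp: nil_def)

lemma nil_zero: "0 \<in> nil"
  by (simp add: nil_def starts_def)

text \<open>If a product started with a recurrent arrow, the whole path would run along the cycle of that arrow, and so
would its right factor, which starts with a nonrecurrent arrow.\<close>
lemma nil_times_left:
  assumes m: "m \<in> nil"
  shows "x \<star> m \<in> nil"
proof -
  have False if a_start: "a \<in> starts (x \<star> m)" and a_rec: "a \<in> recurrent" for a
  proof -
    obtain c n where "path_cycle Q B c n" and a: "c 0 = a" by (rule cycle_through[OF a_rec]) blast
    then interpret path_cycle Q B c n by simp
    obtain p where p: "p \<in> keys (x \<star> m)" "snd p \<noteq> []" "hd (snd p) = c 0"
      using startsE[OF a_start] a by metis
    obtain i where i: "p \<in> B" "i \<le> length (snd p)" "path_drop Q i p \<in> keys m"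
      using keys_times[OF p(1)] by metis
    define l where "l = length (snd p)"
    have "p = seg 0 l" using follow[OF i(1) p(2,3)] by (simp add: l_def)
    then have drop: "path_drop Q i p = seg i l" using i(2) drop_seg[of 0 i l] by (simp add: l_def)
    have "snd (path_drop Q i p) \<noteq> []" using rad_keys[OF _ i(3)] m by (simp add: nil_def)
    then have "i < l" unfolding drop by simp
    then have "c i \<in> starts m" using i(3) unfolding drop
      by (intro startsI[of "seg i l"]) (simp_all add: hd_seg)
    then show False using c_recurrent m by (auto simp: nil_def)
  qed
  moreover have "x \<star> m \<in> rad" using m by (simp add: nil_def)
  ultimately show ?thesis by (auto simp: nil_def)
qed

text \<open>Paths that start with a nonrecurrent arrow have bounded length, so \<open>m\<close> is nilpotent. Instead of
a geometric series the proof uses \<open>(1 + m)(1 - m) = 1 - m\<^sup>2\<close>: passing from \<open>m\<close> to \<open>- m\<^sup>2\<close>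
increases the minimal length \<open>d\<close> of the paths, until it exceeds the bound.\<close>
lemma nil_quasi_inverse:
  assumes "m \<in> nil"
  obtains w where "inverse_pair (unity + m) w"
proof -
  obtain L where L: "\<And>p. p \<in> B \<Longrightarrow> snd p \<noteq> [] \<Longrightarrow> hd (snd p) \<notin> recurrent \<Longrightarrow> length (snd p) \<le> L"
    by (rule nonrecurrent_bounded) blast
  have "\<exists>w. inverse_pair (unity + m) w"
    if "m \<in> nil" "\<And>p. p \<in> keys m \<Longrightarrow> d \<le> length (snd p)" "0 < d" for d and m :: "('v, 'e) qpath \<Rightarrow>\<^sub>0 'a"
    using that
  proof (induction "Suc L - d" arbitrary: d m)
    case 0
    have "p \<notin> keys m" for p
    proof
      assume p: "p \<in> keys m"
      have rad: "m \<in> rad" using 0 by (simp add: nil_def)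
      have ne: "snd p \<noteq> []" by (rule rad_keys[OF rad p])
      have "hd (snd p) \<in> starts m" using p ne by (intro startsI) auto
      then have "hd (snd p) \<notin> recurrent" using 0(2) by (auto simp: nil_def)
      then have "length (snd p) \<le> L" by (rule L[OF keys_in_B[OF rad_elems[OF rad] p] ne])
      then show False using 0 p by fastforce
    qed
    then have "keys m = {}" by blast
    then have "m = 0" by simp
    then have "inverse_pair (unity + m) unity" by (simp add: inverse_pair_def unity_times)
    then show ?case by blast
  next
    case (Suc k)
    have m: "m \<in> rad" "m \<in> elems" using Suc.prems by (auto simp: nil_def rad_def)
    have neg: "0 - m \<star> m \<in> nil"
      by (rule nil_closed(2)[OF nil_zero nil_times_left]) (rule Suc.prems(1))+
    have "Suc d \<le> length (snd p)" if "p \<in> keys (0 - m \<star> m)" for p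
    proof -
      have "p \<in> keys (m \<star> m)" using that by (simp add: in_keys_iff lookup_minus)
      then obtain i where i: "i \<le> length (snd p)" "path_take i p \<in> keys m" "path_drop Q i p \<in> keys m"
        by (rule keys_times)
      have "d \<le> i" "d \<le> length (snd p) - i"
        using Suc.prems(2)[OF i(2)] Suc.prems(2)[OF i(3)] i(1) by auto
      then show ?thesis using Suc.prems(3) by linarith
    qed
    then obtain t where t: "inverse_pair (unity + (0 - m \<star> m)) t"
      using Suc.hyps(1)[of "Suc d" "0 - m \<star> m"] Suc.hyps(2) neg by fastforce
    let ?a = "unity + m" and ?b = "unity - m"
    have el: "?a \<in> elems" "?b \<in> elems" "t \<in> elems"
      using m t by (simp_all add: inverse_pair_def)
    have ab: "?a \<star> ?b = unity + (0 - m \<star> m)" "?b \<star> ?a = unity + (0 - m \<star> m)"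
      using m by (simp_all add: times_add times_minus unity_times times_unity)
    have right: "?a \<star> (?b \<star> t) = unity" and left: "(t \<star> ?b) \<star> ?a = unity"
      using t by (simp_all add: times_assoc[symmetric] ab(1) inverse_pair_def)
        (simp add: times_assoc ab(2))
    have "t \<star> ?b = (t \<star> ?b) \<star> (?a \<star> (?b \<star> t))"
      unfolding right by (simp add: times_unity)
    also have "\<dots> = ?b \<star> t"
      unfolding times_assoc[symmetric] left[unfolded times_assoc[symmetric]] by (simp add: unity_times times_assoc)
    finally have "inverse_pair ?a (?b \<star> t)"
      using right left el(1) by (simp add: inverse_pair_def)
    then show ?case by blast
  qed
  from this[OF assms, of 1] show ?thesis
    using that rad_keys assms by (fastforce simp: nil_def Suc_le_eq)
qed

section \<open>Conjugating systems of idempotents\<close>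

lemma inverse_pair_times:
  assumes "inverse_pair u w" "inverse_pair u' w'"
  shows "inverse_pair (u' \<star> u) (w \<star> w')"
proof -
  have "(u' \<star> u) \<star> (w \<star> w') = u' \<star> ((u \<star> w) \<star> w')" "(w \<star> w') \<star> (u' \<star> u) = w \<star> ((w' \<star> u') \<star> u)"
    by (simp_all add: times_assoc)
  then show ?thesis using assms by (simp add: inverse_pair_def unity_times)
qed

lemma inverse_pair_rad:
  assumes "inverse_pair u w" "u - unity \<in> rad"
  shows "w - unity \<in> rad"
proof -
  have "w - unity = 0 - w \<star> (u - unity)"
    using assms(1) by (simp add: inverse_pair_def times_minus times_unity)
  also have "\<dots> \<in> rad" using assms(2) by (intro rad_closed(2)) simp_all
  finally show ?thesis .
qed

lemma times_rad_unity:
  assumes "u \<in> elems" "u - unity \<in> rad" "u' - unity \<in> rad"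
  shows "u' \<star> u - unity \<in> rad"
proof -
  have "u' \<star> u - unity = (u' - unity) \<star> u + (u - unity)"
    using assms(1) by (simp add: times_minus unity_times)
  also have "\<dots> \<in> rad" using assms by (intro rad_closed(1)) simp_all
  finally show ?thesis .
qed

text \<open>Straightening a cycle removes its arrows from the set of recurrent starting arrows of the differences
\<open>f v - e v\<close> and adds none, so the procedure stops.\<close>
lemma straighten_recurrent:
  assumes "idem_system f"
  shows "\<exists>u w. inverse_pair u w \<and> u - unity \<in> rad \<and> idem_system (\<lambda>v. u \<star> f v \<star> w) \<and>
    (\<forall>v\<in>verts Q. u \<star> f v \<star> w - e v \<in> nil)"
  using assms
proof (induction "card ((\<Union>v\<in>verts Q. starts (f v - e v)) \<inter> recurrent)" arbitrary: f rule: less_induct)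
  case less
  let ?X = "\<lambda>f. (\<Union>v\<in>verts Q. starts (f v - e v)) \<inter> recurrent"
  have fin: "finite (?X f)"
  proof -
    have "finite (starts x)" for x :: "('v, 'e) qpath \<Rightarrow>\<^sub>0 'a"
      by (rule finite_subset[of _ "(\<lambda>p. hd (snd p)) ` keys x"]) (auto simp: starts_def simp del: split_paired_Ex)
    then show ?thesis by simp
  qed
  show ?case
  proof (cases "?X f = {}")
    case True
    have id: "unity \<star> f v \<star> unity = f v" if "v \<in> verts Q" for v
      using idem_systemD(2)[OF less.prems that] by (simp add: unity_times times_unity)
    have inv: "inverse_pair unity unity" by (simp add: inverse_pair_def unity_times)
    have "idem_system (\<lambda>v. unity \<star> f v \<star> unity)"
      by (rule idem_system_conjugate[OF less.prems inv])
        (simp add: id idem_systemD(1)[OF less.prems])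
    moreover have "unity \<star> f v \<star> unity - e v \<in> nil" if "v \<in> verts Q" for v
      using True that idem_systemD(1)[OF less.prems that] by (auto simp: id nil_def)
    ultimately show ?thesis using inv by (metis diff_self rad_closed(3))
  next
    case False
    then obtain a where a: "a \<in> ?X f" by blast
    then obtain c n where "path_cycle Q B c n" and c: "c 0 = a" using cycle_through by blast
    then interpret path_cycle Q B c n by simp
    obtain u w where uw: "inverse_pair u w" "u - unity \<in> rad" "idem_system (\<lambda>v. u \<star> f v \<star> w)"
      "\<And>v. v \<in> verts Q \<Longrightarrow> starts (u \<star> f v \<star> w - e v) \<subseteq> starts (f v - e v) - range c"
      by (rule straighten_cycle[OF less.prems]) blast
    have "?X (\<lambda>v. u \<star> f v \<star> w) \<subseteq> ?X f - {a}"
      using uw(4) c by fast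
    then have "?X (\<lambda>v. u \<star> f v \<star> w) \<subset> ?X f" using a by blast
    then have "card (?X (\<lambda>v. u \<star> f v \<star> w)) < card (?X f)"
      by (rule psubset_card_mono[OF fin])
    from less.hyps[OF this uw(3)]
    obtain u' w' where uw': "inverse_pair u' w'" "u' - unity \<in> rad"
      "idem_system (\<lambda>v. u' \<star> (u \<star> f v \<star> w) \<star> w')"
      "\<forall>v\<in>verts Q. u' \<star> (u \<star> f v \<star> w) \<star> w' - e v \<in> nil" by blast
    have "(u' \<star> u) \<star> f v \<star> (w \<star> w') = u' \<star> (u \<star> f v \<star> w) \<star> w'" for v
      by (simp add: times_assoc)
    moreover have "u' \<star> u - unity \<in> rad"
      using times_rad_unity[OF _ uw(2) uw'(2)] uw(1) by (simp add: inverse_pair_def)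
    ultimately show ?thesis
      using inverse_pair_times[OF uw(1) uw'(1)] uw'(3,4)
      by (intro exI[of _ "u' \<star> u"] exI[of _ "w \<star> w'"]) simp
  qed
qed

text \<open>The classical intertwiner \<open>\<Sum>v. e v f v\<close>, which is \<open>1\<close> plus an element of the nilpotent ideal here.\<close>
lemma straighten_nil:
  assumes f: "idem_system f" and nil: "\<And>v. v \<in> verts Q \<Longrightarrow> f v - e v \<in> nil"
  obtains u w where "inverse_pair u w" "u - unity \<in> rad" "\<And>v. v \<in> verts Q \<Longrightarrow> u \<star> f v = e v \<star> u"
proof -
  define u where "u = (\<Sum>v\<in>verts Q. e v \<star> f v)"
  define m where "m = (\<Sum>v\<in>verts Q. e v \<star> (f v - e v))"
  have "(\<Sum>v\<in>X. e v \<star> (f v - e v)) \<in> nil" if "finite X" "X \<subseteq> verts Q" for X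
    using that by (induction X rule: finite_induct) (simp_all add: nil_zero nil_closed(1) nil_times_left nil)
  then have m: "m \<in> nil" unfolding m_def by simp
  have "(\<Sum>v\<in>verts Q. e v \<star> (f v - e v)) = u - (\<Sum>v\<in>verts Q. e v)"
    by (simp add: u_def times_minus sum_subtractf e_times_e)
  then have u: "u = unity + m" by (simp add: m_def unity_def)
  obtain w where w: "inverse_pair u w" using nil_quasi_inverse[OF m] unfolding u by blast
  have "u \<star> f v = e v \<star> u" if v: "v \<in> verts Q" for v
  proof -
    have "u \<star> f v = (\<Sum>w\<in>verts Q. e w \<star> (f w \<star> f v))" by (simp add: u_def times_sum times_assoc)
    also have "\<dots> = (\<Sum>w\<in>verts Q. if w = v then e v \<star> f v else 0)"
      by (intro sum.cong) (auto simp: idem_systemD(3)[OF f _ v])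
    also have "\<dots> = (\<Sum>w\<in>verts Q. e v \<star> e w \<star> f w)"
      using v by (intro sum.cong) (auto simp: e_times_e)
    also have "\<dots> = e v \<star> u" by (simp add: u_def times_sum times_assoc)
    finally show ?thesis .
  qed
  moreover have "u - unity \<in> rad" using m by (simp add: u nil_def)
  ultimately show ?thesis using that w by blast
qed

text \<open>In \<open>x x\<close> every coefficient is a sum of products in which one factor belongs to a shorter path, or to a
stationary path, where \<open>x\<close> has no coefficient.\<close>
lemma rad_idempotent:
  assumes "x \<in> rad" "x \<star> x = x"
  shows "x = 0"
proof (rule poly_mapping_eqI)
  fix p
  show "lookup x p = lookup 0 p"
  proof (induction "length (snd p)" arbitrary: p rule: less_induct)
    case less
    have st: "lookup x (v, []) = 0" for v using assms(1) by (simp add: rad_def)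
    have "lookup x (path_take i p) * lookup x (path_drop Q i p) = 0" if "i \<le> length (snd p)" for i
    proof (cases "i = length (snd p)")
      case True
      then show ?thesis by (simp add: path_drop_length st)
    next
      case False
      then show ?thesis using less[of "path_take i p"] that by simp
    qed
    then have "lookup (x \<star> x) p = 0" unfolding lookup_times by (simp del: mult_eq_0_iff)
    then show ?case using assms(2) by simp
  qed
qed

text \<open>The coefficient at the stationary path at \<open>w\<close> is multiplicative. It therefore maps exactly one of the
idempotents to \<open>1\<close> and the others to \<open>0\<close>, which defines a map \<open>s\<close> on the vertices. It is onto because
an idempotent that is missed would be in the radical and hence zero.\<close>
lemma idempotents_relabel:
  assumes f: "\<And>v. v \<in> verts Q \<Longrightarrow> f v \<in> elems" "\<And>v. v \<in> verts Q \<Longrightarrow> f v \<noteq> 0"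
    and orth: "\<And>v w. v \<in> verts Q \<Longrightarrow> w \<in> verts Q \<Longrightarrow> f v \<star> f w = (if v = w then f v else 0)"
    and sum: "(\<Sum>v\<in>verts Q. f v) = unity"
  obtains s where "bij_betw s (verts Q) (verts Q)" "idem_system (\<lambda>v. f (s v))"
proof -
  have "\<exists>v\<in>verts Q. \<forall>v'\<in>verts Q. lookup (f v') (w, []) = (if v' = v then 1 else 0)"
    if w: "w \<in> verts Q" for w
  proof -
    have mult: "lookup (f v) (w, []) * lookup (f v') (w, []) = (if v = v' then lookup (f v) (w, []) else 0)"
      if "v \<in> verts Q" "v' \<in> verts Q" for v v'
      using lookup_times_stationary[of "f v" "f v'" w] w orth[OF that] by auto
    have "(\<Sum>v\<in>verts Q. lookup (f v) (w, [])) = 1"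
      using arg_cong[OF sum, of "\<lambda>x. lookup x (w, [])"] w by (simp add: lookup_sum lookup_unity)
    then obtain v where v: "v \<in> verts Q" "lookup (f v) (w, []) \<noteq> 0"
      by (metis sum.neutral zero_neq_one)
    then have "lookup (f v) (w, []) = 1" using mult[OF v(1) v(1)] by simp
    moreover have "lookup (f v') (w, []) = 0" if "v' \<in> verts Q" "v' \<noteq> v" for v'
      using mult[OF v(1) that(1)] v(2) that(2) by auto
    ultimately show ?thesis using v(1) by (intro bexI[of _ v]) auto
  qed
  then obtain s where s: "\<And>w. w \<in> verts Q \<Longrightarrow> s w \<in> verts Q"
    "\<And>v w. w \<in> verts Q \<Longrightarrow> v \<in> verts Q \<Longrightarrow> lookup (f v) (w, []) = (if v = s w then 1 else 0)"
    by metis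
  have "v \<in> s ` verts Q" if v: "v \<in> verts Q" for v
  proof (rule ccontr)
    assume "v \<notin> s ` verts Q"
    then have "lookup (f v) (w, []) = 0" if "w \<in> verts Q" for w
      using s(2)[OF that v] that by auto
    moreover have "lookup (f v) (w, []) = 0" if "w \<notin> verts Q" for w
      using elems_zero[OF f(1)[OF v]] that by (simp add: stationary_B_iff)
    ultimately have "f v \<in> rad" using f(1)[OF v] by (auto simp: rad_def)
    then show False using rad_idempotent[of "f v"] f(2)[OF v] orth[OF v v] by simp
  qed
  then have surj: "s ` verts Q = verts Q" using s(1) by blast
  then have inj: "inj_on s (verts Q)" by (simp add: eq_card_imp_inj_on)
  have bij: "bij_betw s (verts Q) (verts Q)" using surj inj by (simp add: bij_betw_def)
  have "f (s v) - e v \<in> rad" if v: "v \<in> verts Q" for v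
  proof -
    have "lookup (f (s v)) (w, []) = lookup (e v) (w, [])" for w
    proof (cases "w \<in> verts Q")
      case True
      then show ?thesis using s(2)[OF True s(1)[OF v]] inj_onD[OF inj _ v True]
        by (auto simp: lookup_e)
    next
      case False
      then show ?thesis using elems_zero[OF f(1)[OF s(1)[OF v]]] v
        by (auto simp: lookup_e stationary_B_iff)
    qed
    then show ?thesis using f(1)[OF s(1)[OF v]] v by (simp add: rad_def lookup_minus)
  qed
  moreover have "f (s v) \<star> f (s w) = (if v = w then f (s v) else 0)"
    if "v \<in> verts Q" "w \<in> verts Q" for v w
    using orth[OF s(1)[OF that(1)] s(1)[OF that(2)]] inj_onD[OF inj _ that] by auto
  moreover have "(\<Sum>v\<in>verts Q. f (s v)) = unity"
    using sum.reindex_bij_betw[OF bij, of f] sum by simp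
  ultimately have "idem_system (\<lambda>v. f (s v))" by (simp add: idem_system_def)
  then show ?thesis using that bij by blast
qed

theorem idempotents_conjugate:
  assumes "\<And>v. v \<in> verts Q \<Longrightarrow> f v \<in> elems" "\<And>v. v \<in> verts Q \<Longrightarrow> f v \<noteq> 0"
    and "\<And>v w. v \<in> verts Q \<Longrightarrow> w \<in> verts Q \<Longrightarrow> f v \<star> f w = (if v = w then f v else 0)"
    and "(\<Sum>v\<in>verts Q. f v) = unity"
  obtains s u w where "bij_betw s (verts Q) (verts Q)" "inverse_pair u w" "u - unity \<in> rad"
    "\<And>v. v \<in> verts Q \<Longrightarrow> f (s v) = u \<star> e v \<star> w"
proof -
  obtain s where s: "bij_betw s (verts Q) (verts Q)" "idem_system (\<lambda>v. f (s v))"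
    using idempotents_relabel[of f] assms by blast
  obtain u w where uw: "inverse_pair u w" "u - unity \<in> rad" "idem_system (\<lambda>v. u \<star> f (s v) \<star> w)"
    "\<And>v. v \<in> verts Q \<Longrightarrow> u \<star> f (s v) \<star> w - e v \<in> nil"
    using straighten_recurrent[OF s(2)] by blast
  obtain u' w' where uw': "inverse_pair u' w'" "u' - unity \<in> rad"
    "\<And>v. v \<in> verts Q \<Longrightarrow> u' \<star> (u \<star> f (s v) \<star> w) = e v \<star> u'"
    using straighten_nil[OF uw(3,4)] by blast
  let ?u = "w \<star> w'" and ?w = "u' \<star> u"
  have inv: "inverse_pair ?w ?u" by (rule inverse_pair_times[OF uw(1) uw'(1)])
  have "?w - unity \<in> rad" using times_rad_unity[OF _ uw(2) uw'(2)] uw(1) by (simp add: inverse_pair_def)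
  then have "?u - unity \<in> rad" by (rule inverse_pair_rad[OF inv])
  moreover have "f (s v) = ?u \<star> e v \<star> ?w" if v: "v \<in> verts Q" for v
  proof -
    have fv: "f (s v) \<in> elems" using idem_systemD(2)[OF s(2) v] .
    have wu: "w \<star> u = unity" "u \<star> w = unity" "w' \<star> u' = unity"
      using uw(1) uw'(1) by (simp_all add: inverse_pair_def)
    have "?u \<star> e v \<star> ?w = w \<star> (w' \<star> (e v \<star> u')) \<star> u" by (simp add: times_assoc)
    also have "\<dots> = w \<star> ((w' \<star> u') \<star> (u \<star> f (s v) \<star> w)) \<star> u"
      unfolding uw'(3)[OF v, symmetric] by (simp add: times_assoc)
    also have "\<dots> = (w \<star> u) \<star> f (s v) \<star> (w \<star> u)"
      unfolding wu(3) by (simp add: unity_times times_assoc)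
    finally show ?thesis unfolding wu by (simp add: unity_times times_unity fv)
  qed
  moreover have "inverse_pair ?u ?w" using inv by (simp add: inverse_pair_def)
  ultimately show ?thesis using that s(1) by blast
qed

end

section \<open>Ideals of the path algebra that are generated by paths\<close>

context fin_digraph
begin

lemma path_basis_paths: "path_basis G (paths G)"
proof
  fix p and i :: nat
  assume p: "p \<in> paths G" and i: "i \<le> length (snd p)"
  have "awalk (fst p) (take i (snd p) @ drop i (snd p)) (path_target G p)"
    using p by (simp add: paths_def)
  then have "awalk (fst p) (take i (snd p)) (path_target G (path_take i p))
      \<and> awalk (path_target G (path_take i p)) (drop i (snd p)) (path_target G p)"
    unfolding awalk_append_iff by (simp add: path_take_def path_target_def)
  then show "path_take i p \<in> paths G" "path_drop G i p \<in> paths G"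
    using target_path_drop[OF i, of G] by (auto simp: paths_def path_drop_def)
qed (auto simp: paths_def stationary_def path_target_conv awalk_Nil_iff)

end

lemma paths_join:
  assumes "path_take i p \<in> paths Q" "path_drop Q i p \<in> paths Q" "i \<le> length (snd p)" "wf_digraph Q"
  shows "p \<in> paths Q"
proof -
  interpret wf_digraph Q by fact
  have "awalk (fst p) (take i (snd p)) (path_target Q (path_take i p))"
    "awalk (path_target Q (path_take i p)) (drop i (snd p)) (path_target Q p)"
    using assms(1,2) target_path_drop[OF assms(3), of Q] by (auto simp: paths_def path_drop_def)
  then have "awalk (fst p) (take i (snd p) @ drop i (snd p)) (path_target Q p)"
    by (rule awalk_appendI)
  then show ?thesis by (simp add: paths_def)
qed

abbreviation scale :: "'k::field \<Rightarrow> (('v, 'e) qpath \<Rightarrow>\<^sub>0 'k) \<Rightarrow> (('v, 'e) qpath \<Rightarrow>\<^sub>0 'k)" where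
  "scale a \<equiv> Poly_Mapping.map ((*) a)"

lemma path_algebra_simps [simp]:
  "carrier (path_algebra Q) = {f. keys f \<subseteq> paths Q}"
  "monoid.mult (path_algebra Q) = path_mult Q"
  "one (path_algebra Q) = (\<Sum>v\<in>verts Q. path_vec (stationary v))"
  "zero (path_algebra Q) = 0"
  "add (path_algebra Q) = (+)"
  "Module.smult (path_algebra Q) = scale"
  by (simp_all add: path_algebra_def)

lemma poly_mapping_sum_single:
  "finite K \<Longrightarrow> keys x \<subseteq> K \<Longrightarrow> (\<Sum>p\<in>K. Poly_Mapping.single p (lookup x p)) = x"
  by (rule poly_mapping_eqI) (auto simp: lookup_sum lookup_single when_def in_keys_iff)

lemma path_mult_single: "path_mult Q (Poly_Mapping.single p a) (Poly_Mapping.single q b) =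
    (if path_target Q p = fst q then Poly_Mapping.single (fst p, snd p @ snd q) (a * b) else 0)"
  by (simp add: path_mult_def)

lemma path_mult_take_drop: "path_mult Q (Poly_Mapping.single (path_take i p) a)
    (Poly_Mapping.single (path_drop Q i p) b) = Poly_Mapping.single p (a * b)"
  by (simp add: path_mult_single) (simp add: path_drop_def)

context fin_digraph
begin

lemma path_mult_closed:
  assumes "keys x \<subseteq> paths G" "keys y \<subseteq> paths G"
  shows "keys (path_mult G x y) \<subseteq> paths G"
proof
  fix p assume "p \<in> keys (path_mult G x y)"
  then have "(\<Sum>i\<le>length (snd p). lookup x (path_take i p) * lookup y (path_drop G i p)) \<noteq> 0"
    by (simp add: in_keys_iff lookup_path_mult)
  then obtain i where "i \<in> {..length (snd p)}" "lookup x (path_take i p) * lookup y (path_drop G i p) \<noteq> 0"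
    by (rule sum.not_neutral_contains_not_neutral)
  then show "p \<in> paths G"
    using assms by (intro paths_join[of i p]) (auto simp: in_keys_iff wf_digraph_axioms)
qed

lemma ring_path_algebra: "ring (path_algebra G :: ('k::field, _) module)"
proof -
  note full = path_basis_paths
  have unity: "(\<Sum>v\<in>verts G. path_vec (stationary v)) = (path_basis.unity G :: _ \<Rightarrow>\<^sub>0 'k)"
    by (simp add: path_basis.unity_def[OF full])
  have elems: "x \<in> path_basis.elems (paths G) \<longleftrightarrow> keys x \<subseteq> paths G" for x :: "_ \<Rightarrow>\<^sub>0 'k"
    by (simp add: path_basis.elems_def[OF full])
  have times: "path_basis.times G (paths G) x y = path_mult G x y"
    if "keys x \<subseteq> paths G" "keys y \<subseteq> paths G" for x y :: "_ \<Rightarrow>\<^sub>0 'k"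
  proof (rule poly_mapping_eqI)
    fix p
    show "lookup (path_basis.times G (paths G) x y) p = lookup (path_mult G x y) p"
      using path_mult_closed[OF that]
      by (auto simp: path_basis.times_def[OF full] path_basis.lookup_trunc[OF full] in_keys_iff
          simp del: split_paired_All)
  qed
  have one: "keys (path_basis.unity G :: _ \<Rightarrow>\<^sub>0 'k) \<subseteq> paths G"
    using path_basis.unity_in_elems[OF full] by (simp flip: elems)
  show ?thesis
  proof (rule ringI)
    show "abelian_group (path_algebra G :: ('k, _) module)"
    proof (rule abelian_groupI)
      fix x y :: "_ \<Rightarrow>\<^sub>0 'k"
      assume "x \<in> carrier (path_algebra G)" "y \<in> carrier (path_algebra G)"
      then show "x \<oplus>\<^bsub>path_algebra G\<^esub> y \<in> carrier (path_algebra G)"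
        using keys_add[of x y] by auto
    next
      fix x :: "_ \<Rightarrow>\<^sub>0 'k"
      assume "x \<in> carrier (path_algebra G)"
      then show "\<exists>y\<in>carrier (path_algebra G). y \<oplus>\<^bsub>path_algebra G\<^esub> x = \<zero>\<^bsub>path_algebra G\<^esub>"
        by (intro bexI[of _ "- x"]) auto
    qed (auto simp: ac_simps)
    show "Group.monoid (path_algebra G :: ('k, _) module)"
    proof (rule monoidI)
      fix x y :: "_ \<Rightarrow>\<^sub>0 'k"
      assume x: "x \<in> carrier (path_algebra G)"
      show "\<one>\<^bsub>path_algebra G\<^esub> \<otimes>\<^bsub>path_algebra G\<^esub> x = x"
        using path_basis.unity_times[OF full, of x] x one by (simp add: unity elems times)
      show "x \<otimes>\<^bsub>path_algebra G\<^esub> \<one>\<^bsub>path_algebra G\<^esub> = x"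
        using path_basis.times_unity[OF full, of x] x one by (simp add: unity elems times)
      assume "y \<in> carrier (path_algebra G)"
      then show "x \<otimes>\<^bsub>path_algebra G\<^esub> y \<in> carrier (path_algebra G)"
        using x path_mult_closed by simp
    qed (use one in \<open>simp_all add: unity path_mult_assoc\<close>)
  qed (simp_all add: path_mult_add)
qed

end

context string_relations
begin

text \<open>The functions supported on the paths with a factor in the generating set form an ideal, and each
such path is a product of a generator with two other paths. So \<open>I\<close> is this ideal, and membership
can be tested on the support. Factors of stationary paths have length \<open>0\<close>, and generators are longer.\<close>
lemma I_ideal: "ideal I (path_algebra Q)"
  and I_keys: "f \<in> I \<longleftrightarrow> keys f \<subseteq> {p \<in> paths Q. path_vec p \<in> I}"
  and stationary_notin_I: "path_vec (stationary v) \<notin> I"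
proof -
  obtain P where P: "P \<subseteq> {p \<in> paths Q. path_length p \<ge> 2}"
    "I = Idl\<^bsub>path_algebra Q\<^esub> (path_vec ` P)" using generated_by_paths by blast
  let ?R = "path_algebra Q :: ('k, ('v, 'e) qpath \<Rightarrow>\<^sub>0 'k) module"
  interpret R: ring ?R by (rule ring_path_algebra)
  have P_carrier: "(path_vec ` P :: (('v, 'e) qpath \<Rightarrow>\<^sub>0 'k) set) \<subseteq> carrier ?R" using P(1) by auto
  have I: "ideal I ?R" unfolding P(2) using P_carrier by (rule R.genideal_ideal)
  interpret I: ideal I ?R by (rule I)
  have P_I: "path_vec q \<in> I" if "q \<in> P" for q
    using R.genideal_self[OF P_carrier] that unfolding P(2) by blast
  define Z where "Z = {p \<in> paths Q. \<exists>i k. i + k \<le> length (snd p) \<and> path_take k (path_drop Q i p) \<in> P}"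
  have Z_take: "p \<in> Z" if take: "path_take i p \<in> Z" and "i \<le> length (snd p)" "p \<in> paths Q" for i p
  proof -
    obtain j k where "j + k \<le> length (snd (path_take i p))"
      and P: "path_take k (path_drop Q j (path_take i p)) \<in> P"
      using take unfolding Z_def by blast
    then have jk: "j + k \<le> i" "path_take k (path_drop Q j (path_take i p)) \<in> P" by simp_all
    then have "path_take k (path_drop Q j p) \<in> P"
      by (simp add: path_drop_take path_take_take)
    moreover have "j + k \<le> length (snd p)" using jk(1) that(2) by linarith
    ultimately show ?thesis using that(3) unfolding Z_def by blast
  qed
  have Z_drop: "p \<in> Z" if drop: "path_drop Q i p \<in> Z" and "i \<le> length (snd p)" "p \<in> paths Q" for i p
  proof -
    obtain j k where "j + k \<le> length (snd (path_drop Q i p))"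
      and P: "path_take k (path_drop Q j (path_drop Q i p)) \<in> P"
      using drop unfolding Z_def by blast
    then have jk: "j + k \<le> length (snd p) - i" by simp
    then have "path_take k (path_drop Q (i + j) p) \<in> P"
      using path_drop_drop[of i "i + j" p Q] that(2) jk P by simp
    moreover have "i + j + k \<le> length (snd p)" using jk that(2) by linarith
    ultimately show ?thesis using that(3) unfolding Z_def by blast
  qed
  have mult: "keys (path_mult Q x y) \<subseteq> Z"
    if "keys x \<subseteq> paths Q" "keys y \<subseteq> paths Q" "keys x \<subseteq> Z \<or> keys y \<subseteq> Z" for x y :: "_ \<Rightarrow>\<^sub>0 'k"
  proof
    fix p assume p: "p \<in> keys (path_mult Q x y)"
    then have "(\<Sum>i\<le>length (snd p). lookup x (path_take i p) * lookup y (path_drop Q i p)) \<noteq> 0"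
      by (simp add: in_keys_iff lookup_path_mult)
    then obtain i where i: "i \<in> {..length (snd p)}"
      "lookup x (path_take i p) * lookup y (path_drop Q i p) \<noteq> 0"
      by (rule sum.not_neutral_contains_not_neutral)
    have "p \<in> paths Q" using path_mult_closed[OF that(1,2)] p by blast
    moreover have "path_take i p \<in> keys x" "path_drop Q i p \<in> keys y"
      using i by (auto simp: in_keys_iff)
    ultimately show "p \<in> Z" using Z_take[of i p] Z_drop[of i p] that(3) i(1) unfolding atMost_iff by blast
  qed
  have Z_paths: "Z \<subseteq> paths Q" by (auto simp: Z_def)
  have J: "ideal {f :: _ \<Rightarrow>\<^sub>0 'k. keys f \<subseteq> Z} ?R"
  proof (rule idealI)
    show "ring ?R" by (rule R.ring_axioms)
    show "subgroup {f :: _ \<Rightarrow>\<^sub>0 'k. keys f \<subseteq> Z} (add_monoid ?R)"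
    proof (rule R.add.subgroupI)
      fix x y :: "_ \<Rightarrow>\<^sub>0 'k" assume x: "x \<in> {f. keys f \<subseteq> Z}"
      have "\<ominus>\<^bsub>?R\<^esub> x = - x" by (rule R.minus_equality) (use x Z_paths in auto)
      then show "\<ominus>\<^bsub>?R\<^esub> x \<in> {f. keys f \<subseteq> Z}" using x by simp
      assume "y \<in> {f. keys f \<subseteq> Z}"
      then show "x \<oplus>\<^bsub>?R\<^esub> y \<in> {f. keys f \<subseteq> Z}" using x keys_add[of x y] by auto
    next
      show "{f :: _ \<Rightarrow>\<^sub>0 'k. keys f \<subseteq> Z} \<noteq> {}" by (auto intro!: exI[of _ 0])
    qed (use Z_paths in \<open>auto simp del: split_paired_All\<close>)
  next
    fix a x assume "a \<in> {f :: _ \<Rightarrow>\<^sub>0 'k. keys f \<subseteq> Z}" "x \<in> carrier ?R"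
    then have "keys a \<subseteq> Z" "keys a \<subseteq> paths Q" "keys x \<subseteq> paths Q" using Z_paths by auto
    then show "x \<otimes>\<^bsub>?R\<^esub> a \<in> {f. keys f \<subseteq> Z}" "a \<otimes>\<^bsub>?R\<^esub> x \<in> {f. keys f \<subseteq> Z}"
      using mult[of x a] mult[of a x] by simp_all
  qed
  have "path_vec q \<in> {f :: _ \<Rightarrow>\<^sub>0 'k. keys f \<subseteq> Z}" if "q \<in> P" for q
  proof -
    have "path_take (length (snd q)) (path_drop Q 0 q) \<in> P" "0 + length (snd q) \<le> length (snd q)"
      using that by simp_all
    then have "q \<in> Z" using P(1) that unfolding Z_def by blast
    then show ?thesis by simp
  qed
  then have "I \<subseteq> {f. keys f \<subseteq> Z}"
    unfolding P(2) by (intro R.genideal_minimal[OF J]) auto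
  moreover have "f \<in> I" if f: "keys f \<subseteq> Z" for f
  proof -
    have single: "Poly_Mapping.single p a \<in> I" if p: "p \<in> Z" for p a
    proof -
      obtain i k where ik: "i + k \<le> length (snd p)" "path_take k (path_drop Q i p) \<in> P"
        using p by (auto simp: Z_def)
      let ?q = "path_take k (path_drop Q i p)"
      have basis: "path_basis Q (paths Q)" by (rule path_basis_paths)
      have pp: "p \<in> paths Q" using p Z_paths by blast
      have take: "path_take i p \<in> paths Q" and drop: "path_drop Q (i + k) p \<in> paths Q"
        using path_basis.take_in_B[OF basis pp] path_basis.drop_in_B[OF basis pp] ik(1) by simp_all
      have rest: "path_drop Q k (path_drop Q i p) = path_drop Q (i + k) p"
        using path_drop_drop[of i "i + k" p Q] ik(1) by simp
      have "path_mult Q (path_vec ?q) (path_vec (path_drop Q (i + k) p)) \<in> I"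
        using I.I_r_closed[OF P_I[OF ik(2)], of "path_vec (path_drop Q (i + k) p)"] drop by simp
      also have "path_mult Q (path_vec ?q) (path_vec (path_drop Q (i + k) p)) = (path_vec (path_drop Q i p) :: _ \<Rightarrow>\<^sub>0 'k)"
        using path_mult_take_drop[of Q k "path_drop Q i p" "1 :: 'k" 1] by (simp add: rest)
      finally have "path_mult Q (Poly_Mapping.single (path_take i p) a) (path_vec (path_drop Q i p)) \<in> I"
        using I.I_l_closed[of "path_vec (path_drop Q i p)" "Poly_Mapping.single (path_take i p) a"] take
        by simp
      then show ?thesis using path_mult_take_drop[of Q i p a 1] by simp
    qed
    have "(\<Sum>p\<in>K. Poly_Mapping.single p (lookup f p)) \<in> I" if "finite K" "K \<subseteq> Z" for K
      using that
    proof (induction K rule: finite_induct)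
      case empty
      then show ?case using I.zero_closed by simp
    next
      case (insert p K)
      then show ?case using I.a_closed[of "Poly_Mapping.single p (lookup f p)"] single by simp
    qed
    from this[of "keys f"] show ?thesis using f poly_mapping_sum_single[of "keys f" f] by simp
  qed
  ultimately have I_Z: "f \<in> I \<longleftrightarrow> keys f \<subseteq> Z" for f by blast
  then have "path_vec p \<in> I \<longleftrightarrow> p \<in> Z" for p by simp
  then show "f \<in> I \<longleftrightarrow> keys f \<subseteq> {p \<in> paths Q. path_vec p \<in> I}"
    unfolding I_Z using Z_paths by blast
  have "stationary v \<notin> Z"
  proof
    assume "stationary v \<in> Z"
    then obtain i k where "path_take k (path_drop Q i (stationary v)) \<in> P"
      by (auto simp: Z_def)
    then have "2 \<le> path_length (path_take k (path_drop Q i (stationary v)))" using P(1) by blast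
    then show False by (simp add: path_length_def stationary_def)
  qed
  then show "path_vec (stationary v) \<notin> I" unfolding I_Z by simp
  show "ideal I ?R" by (rule I)
qed

definition nonzero_paths :: "('v, 'e) qpath set" where
  "nonzero_paths = {p \<in> paths Q. path_vec p \<notin> I}"

lemma string_basis_nonzero_paths: "string_basis Q nonzero_paths"
proof -
  interpret I: ideal I "path_algebra Q" by (rule I_ideal)
  have full: "path_basis Q (paths Q)" by (rule path_basis_paths)
  have split: "path_take i p \<in> nonzero_paths \<and> path_drop Q i p \<in> nonzero_paths"
    if p: "p \<in> nonzero_paths" and i: "i \<le> length (snd p)" for p i
  proof -
    have paths: "path_take i p \<in> paths Q" "path_drop Q i p \<in> paths Q"
      using path_basis.take_in_B[OF full] path_basis.drop_in_B[OF full] p i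
      by (simp_all add: nonzero_paths_def)
    have "path_mult Q (path_vec (path_take i p)) (path_vec (path_drop Q i p)) = (path_vec p :: _ \<Rightarrow>\<^sub>0 'k)"
      by (simp add: path_mult_take_drop)
    moreover have "path_mult Q x y \<in> I" if "x \<in> I \<and> keys y \<subseteq> paths Q \<or> keys x \<subseteq> paths Q \<and> y \<in> I" for x y
      using that I.I_r_closed[of x y] I.I_l_closed[of y x] by auto
    ultimately have "path_vec (path_take i p) \<notin> I" "path_vec (path_drop Q i p) \<notin> I"
      using paths p by (metis (no_types, lifting) empty_subsetI insert_subset keys_single mem_Collect_eq nonzero_paths_def)+
    then show ?thesis using paths by (simp add: nonzero_paths_def)
  qed
  have two: "a \<in> arcs Q \<and> b \<in> arcs Q \<and> head Q a = tail Q b \<and> path_vec (tail Q a, [a, b]) \<notin> I"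
    if "(tail Q a, [a, b]) \<in> nonzero_paths" for a b
    using that by (auto simp: nonzero_paths_def paths_def awalk_def)
  show ?thesis
  proof
    show "nonzero_paths \<subseteq> paths Q" by (auto simp: nonzero_paths_def)
  next
    fix p i assume "p \<in> nonzero_paths" "i \<le> length (snd p)"
    then show "path_take i p \<in> nonzero_paths" "path_drop Q i p \<in> nonzero_paths"
      using split by blast+
  next
    fix v assume "v \<in> verts Q"
    then show "stationary v \<in> nonzero_paths"
      using path_basis.stationary_in_B[OF full] stationary_notin_I by (simp add: nonzero_paths_def)
  next
    fix a b b' assume "(tail Q a, [a, b]) \<in> nonzero_paths" "(tail Q a, [a, b']) \<in> nonzero_paths"
    then show "b = b'" using two[of a b] two[of a b'] outgoing_relation[of a b b'] by blast
  next
    fix a b b' assume "(tail Q b, [b, a]) \<in> nonzero_paths" "(tail Q b', [b', a]) \<in> nonzero_paths"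
    then have "\<not> b \<noteq> b'"
      using two[of b a] two[of b' a] incoming_relation[of a b b'] by metis
    then show "b = b'" by blast
  qed
qed

end

sublocale string_relations \<subseteq> string_basis Q nonzero_paths
  by (rule string_basis_nonzero_paths)

section \<open>The quotient algebra in terms of nonzero paths\<close>

lemma scale_single: "scale a (Poly_Mapping.single p b) = Poly_Mapping.single p (a * b)"
  by (rule poly_mapping_eqI) (simp add: lookup_smult lookup_single when_def)

lemma keys_scale: "keys (scale a x) \<subseteq> keys x"
  by (auto simp: in_keys_iff lookup_smult simp del: split_paired_All)

lemma (in path_basis) scale_times:
  "scale a x \<star> y = scale a (x \<star> y)" "x \<star> scale a y = scale a (x \<star> y)"
  by (rule poly_mapping_eqI; simp add: lookup_times lookup_smult sum_distrib_left mult_ac)+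

lemma (in path_basis) scale_in_elems: "x \<in> elems \<Longrightarrow> scale a x \<in> elems"
  using keys_scale[of a x] by (auto simp: elems_def)

lemma alg_auto_compose:
  assumes "ring A" and smult: "\<And>a x. x \<in> carrier A \<Longrightarrow> a \<odot>\<^bsub>A\<^esub> x \<in> carrier A"
    and \<phi>: "\<phi> \<in> alg_auto A" and \<psi>: "\<psi> \<in> alg_auto A"
  shows "compose (carrier A) \<phi> \<psi> \<in> alg_auto A"
proof -
  interpret ring A by fact
  have hom: "\<phi> \<in> ring_hom A A" "\<psi> \<in> ring_hom A A"
    and bij: "\<phi> \<in> Bij (carrier A)" "\<psi> \<in> Bij (carrier A)"
    and lin: "\<And>a x. x \<in> carrier A \<Longrightarrow> \<phi> (a \<odot>\<^bsub>A\<^esub> x) = a \<odot>\<^bsub>A\<^esub> \<phi> x"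
      "\<And>a x. x \<in> carrier A \<Longrightarrow> \<psi> (a \<odot>\<^bsub>A\<^esub> x) = a \<odot>\<^bsub>A\<^esub> \<psi> x"
    using \<phi> \<psi> by (simp_all add: alg_auto_def)
  note \<phi>_hom = ring_hom_memE[OF hom(1)] and \<psi>_hom = ring_hom_memE[OF hom(2)]
  have "compose (carrier A) \<phi> \<psi> \<in> ring_hom A A"
    by (rule ring_hom_memI) (simp_all add: compose_def \<phi>_hom \<psi>_hom)
  moreover have "compose (carrier A) \<phi> \<psi> \<in> Bij (carrier A)"
    using bij by (rule compose_Bij)
  ultimately show ?thesis
    by (simp add: alg_auto_def compose_def smult lin \<psi>_hom)
qed

context string_relations
begin

notation times (infixl \<open>\<star>\<close> 70)

abbreviation A :: "('k, (('v, 'e) qpath \<Rightarrow>\<^sub>0 'k) set) module" where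
  "A \<equiv> quiver_algebra Q I"

text \<open>Restricted to \<open>elems\<close>, this map is an isomorphism from the model onto the quotient algebra: every coset
contains exactly one function that is supported on the nonzero paths.\<close>
definition cls :: "(('v, 'e) qpath \<Rightarrow>\<^sub>0 'k) \<Rightarrow> (('v, 'e) qpath \<Rightarrow>\<^sub>0 'k) set" where
  "cls x = I +>\<^bsub>path_algebra Q\<^esub> x"

lemma I_closed: "0 \<in> I" "x \<in> I \<Longrightarrow> y \<in> I \<Longrightarrow> x + y \<in> I" "x \<in> I \<Longrightarrow> y \<in> I \<Longrightarrow> x - y \<in> I"
  "x \<in> I \<Longrightarrow> scale a x \<in> I"
proof -
  have I: "z \<in> I \<Longrightarrow> keys z \<subseteq> {p \<in> paths Q. path_vec p \<in> I}"
    "keys z \<subseteq> {p \<in> paths Q. path_vec p \<in> I} \<Longrightarrow> z \<in> I" for z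
    using I_keys[of z] by blast+
  show "0 \<in> I" by (rule I(2)) simp
  show "x \<in> I \<Longrightarrow> y \<in> I \<Longrightarrow> x + y \<in> I" using I keys_add[of x y] by blast
  show "x \<in> I \<Longrightarrow> y \<in> I \<Longrightarrow> x - y \<in> I" using I keys_diff[of x y] by blast
  show "x \<in> I \<Longrightarrow> scale a x \<in> I" using I keys_scale[of a x] by blast
qed

lemma cls_conv: "cls x = (\<lambda>h. h + x) ` I"
  by (auto simp: cls_def a_r_coset_def')

lemma in_cls_iff: "y \<in> cls x \<longleftrightarrow> y - x \<in> I"
  unfolding cls_conv by (auto intro!: image_eqI[of _ _ "y - x"])

lemma cls_eq_iff: "cls x = cls y \<longleftrightarrow> x - y \<in> I"
proof
  assume "cls x = cls y"
  moreover have "x \<in> cls x" by (simp add: in_cls_iff I_closed)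
  ultimately show "x - y \<in> I" by (simp add: in_cls_iff)
next
  assume xy: "x - y \<in> I"
  have "z - y \<in> I" if "z - x \<in> I" for z using I_closed(2)[OF that xy] by simp
  moreover have "z - x \<in> I" if "z - y \<in> I" for z using I_closed(3)[OF that xy] by simp
  ultimately show "cls x = cls y" by (auto simp: in_cls_iff simp del: split_paired_All)
qed

lemma cls_inj:
  assumes "x \<in> elems" "y \<in> elems" "cls x = cls y"
  shows "x = y"
proof -
  have "keys (x - y) \<subseteq> nonzero_paths"
    using elems_closed(2)[OF assms(1,2)] by (simp add: elems_def)
  moreover have "keys (x - y) \<subseteq> {p \<in> paths Q. path_vec p \<in> I}"
    using assms(3) I_keys[of "x - y"] cls_eq_iff by blast
  ultimately have "keys (x - y) = {}" unfolding nonzero_paths_def by blast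
  then show ?thesis by simp
qed

lemma cls_trunc: "keys x \<subseteq> paths Q \<Longrightarrow> cls (trunc x) = cls x"
proof -
  assume x: "keys x \<subseteq> paths Q"
  have "keys (trunc x - x) \<subseteq> {p \<in> paths Q. path_vec p \<in> I}"
  proof
    fix p assume "p \<in> keys (trunc x - x)"
    then have "p \<notin> nonzero_paths" "p \<in> keys x"
      by (auto simp: in_keys_iff lookup_minus lookup_trunc split: if_splits simp del: split_paired_All)
    then show "p \<in> {p \<in> paths Q. path_vec p \<in> I}" using x by (auto simp: nonzero_paths_def)
  qed
  then show ?thesis using I_keys[of "trunc x - x"] cls_eq_iff by blast
qed

lemma elems_paths: "x \<in> elems \<Longrightarrow> keys x \<subseteq> paths Q"
  using B_paths unfolding elems_def by blast

lemma A_carrier: "carrier A = cls ` elems"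
proof -
  have "carrier A = cls ` {f. keys f \<subseteq> paths Q}"
    by (auto simp: quiver_algebra_def quotient_algebra_def FactRing_def A_RCOSETS_def' cls_def)
  also have "\<dots> = cls ` elems"
  proof
    show "cls ` {f. keys f \<subseteq> paths Q} \<subseteq> cls ` elems"
    proof
      fix X assume "X \<in> cls ` {f. keys f \<subseteq> paths Q}"
      then obtain f where "X = cls f" "keys f \<subseteq> paths Q" by blast
      then have "X = cls (trunc f)" by (simp add: cls_trunc)
      moreover have "trunc f \<in> elems" by (simp add: elems_iff lookup_trunc)
      ultimately show "X \<in> cls ` elems" by blast
    qed
  qed (use elems_paths in blast)
  finally show ?thesis .
qed

lemma cls_in_A [simp]: "x \<in> elems \<Longrightarrow> cls x \<in> carrier A"
  by (simp add: A_carrier)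

lemma A_one: "\<one>\<^bsub>A\<^esub> = cls unity" and A_zero: "\<zero>\<^bsub>A\<^esub> = cls 0"
  by (simp_all add: quiver_algebra_def quotient_algebra_def FactRing_def cls_def unity_def)
    (auto simp: cls_conv[unfolded cls_def])

lemma A_add:
  assumes "x \<in> elems" "y \<in> elems"
  shows "cls x \<oplus>\<^bsub>A\<^esub> cls y = cls (x + y)"
  using ideal.a_rcos_sum[OF I_ideal, of x y] elems_paths[OF assms(1)] elems_paths[OF assms(2)]
  by (simp add: quiver_algebra_def quotient_algebra_def FactRing_def cls_def)

lemma A_mult:
  assumes "x \<in> elems" "y \<in> elems"
  shows "cls x \<otimes>\<^bsub>A\<^esub> cls y = cls (x \<star> y)"
proof -
  have "cls x \<otimes>\<^bsub>A\<^esub> cls y = cls (path_mult Q x y)"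
    using ideal.rcoset_mult_add[OF I_ideal, of x y] elems_paths[OF assms(1)] elems_paths[OF assms(2)]
    by (simp add: quiver_algebra_def quotient_algebra_def FactRing_def cls_def)
  also have "\<dots> = cls (x \<star> y)"
    unfolding times_def
    using cls_trunc[OF path_mult_closed[OF elems_paths[OF assms(1)] elems_paths[OF assms(2)]]] by simp
  finally show ?thesis .
qed

lemma A_smult: "a \<odot>\<^bsub>A\<^esub> cls x = cls (scale a x)"
proof -
  have "cls (scale a y) = cls (scale a x)" if "y \<in> cls x" for y
  proof -
    have "scale a y - scale a x = scale a (y - x)"
      by (rule poly_mapping_eqI) (simp add: lookup_smult lookup_minus right_diff_distrib)
    then show ?thesis using that I_closed(4)[of "y - x" a] by (simp add: cls_eq_iff in_cls_iff)
  qed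
  moreover have "x \<in> cls x" by (simp add: in_cls_iff I_closed)
  moreover have "a \<odot>\<^bsub>A\<^esub> cls x = (\<Union>y\<in>cls x. cls (scale a y))"
    by (simp add: quiver_algebra_def quotient_algebra_def cls_def)
  ultimately show ?thesis by blast
qed

lemma ring_A: "ring A"
proof (rule ringI)
  show "abelian_group A"
  proof (rule abelian_groupI)
    fix X assume "X \<in> carrier A"
    then obtain x where x: "x \<in> elems" "X = cls x" by (auto simp: A_carrier)
    have "0 - x \<in> elems" using x by (intro elems_closed(2)) simp_all
    then show "\<exists>Y\<in>carrier A. Y \<oplus>\<^bsub>A\<^esub> X = \<zero>\<^bsub>A\<^esub>"
      using x by (intro bexI[of _ "cls (0 - x)"]) (simp_all only: A_add A_zero cls_in_A diff_add_cancel)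
  qed (auto simp: A_carrier A_add A_zero ac_simps)
  show "Group.monoid A"
    by (rule monoidI) (auto simp: A_carrier A_mult A_one unity_times times_unity times_assoc)
qed (auto simp: A_carrier A_mult A_add times_add)

lemma finsum_path_classes:
  assumes "finite K" "K \<subseteq> nonzero_paths"
  shows "(\<Oplus>\<^bsub>A\<^esub>X\<in>(\<lambda>p. cls (path_vec p)) ` K. c X \<odot>\<^bsub>A\<^esub> X)
    = cls (\<Sum>p\<in>K. Poly_Mapping.single p (c (cls (path_vec p))))"
  using assms
proof (induction K rule: finite_induct)
  case empty
  interpret ring A by (rule ring_A)
  show ?case by (simp add: A_zero)
next
  case (insert p K)
  interpret ring A by (rule ring_A)
  have vec: "path_vec q \<in> elems" if "q \<in> nonzero_paths" for q
    using that by (simp add: elems_def)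
  have single: "Poly_Mapping.single q a \<in> elems" if "q \<in> nonzero_paths" for q a
    using that by (simp add: elems_def)
  have term_eq: "c (cls (path_vec q)) \<odot>\<^bsub>A\<^esub> cls (path_vec q) = cls (Poly_Mapping.single q (c (cls (path_vec q))))" for q
    by (simp add: A_smult scale_single)
  have "p = q" if "q \<in> K" "cls (path_vec p) = cls (path_vec q)" for q
  proof -
    have "(path_vec p :: _ \<Rightarrow>\<^sub>0 'k) = path_vec q"
      by (rule cls_inj[OF vec vec]) (use that insert.prems in auto)
    then have "lookup (path_vec p :: _ \<Rightarrow>\<^sub>0 'k) q = 1" by simp
    then show ?thesis by (simp add: lookup_single when_def split: if_splits)
  qed
  then have "cls (path_vec p) \<notin> (\<lambda>p. cls (path_vec p)) ` K" using insert.hyps by auto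
  moreover have "(\<lambda>X. c X \<odot>\<^bsub>A\<^esub> X) \<in> (\<lambda>p. cls (path_vec p)) ` K \<rightarrow> carrier A"
    using insert.prems by (auto simp: term_eq intro!: cls_in_A single)
  moreover have "c (cls (path_vec p)) \<odot>\<^bsub>A\<^esub> cls (path_vec p) \<in> carrier A"
    using insert.prems by (auto simp: term_eq intro!: cls_in_A single)
  ultimately have "(\<Oplus>\<^bsub>A\<^esub>X\<in>(\<lambda>p. cls (path_vec p)) ` insert p K. c X \<odot>\<^bsub>A\<^esub> X)
      = c (cls (path_vec p)) \<odot>\<^bsub>A\<^esub> cls (path_vec p)
        \<oplus>\<^bsub>A\<^esub> (\<Oplus>\<^bsub>A\<^esub>X\<in>(\<lambda>p. cls (path_vec p)) ` K. c X \<odot>\<^bsub>A\<^esub> X)"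
    using insert.hyps by (simp add: finsum_insert)
  also have "\<dots> = cls (Poly_Mapping.single p (c (cls (path_vec p))))
        \<oplus>\<^bsub>A\<^esub> cls (\<Sum>p\<in>K. Poly_Mapping.single p (c (cls (path_vec p))))"
    using insert by (simp add: term_eq)
  also have "\<dots> = cls (\<Sum>p\<in>insert p K. Poly_Mapping.single p (c (cls (path_vec p))))"
    using insert by (subst A_add) (auto intro!: single elems_sum)
  finally show ?case .
qed

lemma lin_span_path_classes:
  assumes "S \<subseteq> nonzero_paths"
  shows "lin_span A (path_class Q I ` S) = cls ` {x. keys x \<subseteq> S}"
proof -
  have pc: "path_class Q I = (\<lambda>p. cls (path_vec p))"
    by (rule ext) (simp add: path_class_def cls_def)
  have inj: "inj_on (\<lambda>p. cls (path_vec p)) S"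
  proof (rule inj_onI)
    fix p q assume pq: "p \<in> S" "q \<in> S" "cls (path_vec p) = cls (path_vec q)"
    have "(path_vec p :: _ \<Rightarrow>\<^sub>0 'k) = path_vec q"
      by (rule cls_inj) (use pq assms in \<open>auto simp: elems_def\<close>)
    then have "lookup (path_vec p :: _ \<Rightarrow>\<^sub>0 'k) q = 1" by simp
    then show "p = q" by (simp add: lookup_single when_def split: if_splits)
  qed
  show ?thesis
    unfolding pc
  proof (intro equalityI subsetI)
    fix X assume "X \<in> lin_span A ((\<lambda>p. cls (path_vec p)) ` S)"
    then obtain c F where X: "X = (\<Oplus>\<^bsub>A\<^esub>x\<in>F. c x \<odot>\<^bsub>A\<^esub> x)" "finite F"
      "F \<subseteq> (\<lambda>p. cls (path_vec p)) ` S" unfolding lin_span_def by blast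
    obtain K where K: "K \<subseteq> S" "finite K" "F = (\<lambda>p. cls (path_vec p)) ` K"
      using finite_subset_image[OF X(2,3)] by blast
    define x where "x = (\<Sum>p\<in>K. Poly_Mapping.single p (c (cls (path_vec p))))"
    have "X = cls x"
      unfolding X(1) K(3) x_def by (rule finsum_path_classes) (use K assms in auto)
    moreover have "lookup x p = 0" if "p \<notin> S" for p
      unfolding x_def lookup_sum using K(1) that by (intro sum.neutral) (auto simp: lookup_single when_def)
    then have "keys x \<subseteq> S" by (auto simp: in_keys_iff simp del: split_paired_All)
    ultimately show "X \<in> cls ` {x. keys x \<subseteq> S}" by blast
  next
    fix X assume "X \<in> cls ` {x. keys x \<subseteq> S}"
    then obtain x where x: "keys x \<subseteq> S" "X = cls x" by blast
    define c where "c Y = lookup x (inv_into S (\<lambda>p. cls (path_vec p)) Y)" for Y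
    have "c (cls (path_vec p)) = lookup x p" if "p \<in> keys x" for p
      using inv_into_f_f[OF inj, of p] subsetD[OF x(1) that] by (simp add: c_def)
    then have "(\<Sum>p\<in>keys x. Poly_Mapping.single p (c (cls (path_vec p))))
        = (\<Sum>p\<in>keys x. Poly_Mapping.single p (lookup x p))"
      by (intro sum.cong) auto
    also have "\<dots> = x" by (rule poly_mapping_sum_single) simp_all
    finally have sum: "(\<Sum>p\<in>keys x. Poly_Mapping.single p (c (cls (path_vec p)))) = x" .
    have "X = (\<Oplus>\<^bsub>A\<^esub>X\<in>(\<lambda>p. cls (path_vec p)) ` keys x. c X \<odot>\<^bsub>A\<^esub> X)"
      unfolding x(2) using finsum_path_classes[of "keys x" c] x(1) assms sum by simp
    then show "X \<in> lin_span A ((\<lambda>p. cls (path_vec p)) ` S)"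
      unfolding lin_span_def
      by (intro CollectI exI[of _ c] exI[of _ "(\<lambda>p. cls (path_vec p)) ` keys x"] conjI)
        (use x(1) in \<open>simp_all add: image_mono\<close>)
  qed
qed

lemma A_plus_conv: "A_plus Q I = cls ` rad"
proof -
  let ?S = "{p \<in> paths Q. path_length p \<ge> 1 \<and> path_vec p \<notin> I}"
  have "A_plus Q I = cls ` {x. keys x \<subseteq> ?S}"
    unfolding A_plus_def by (rule lin_span_path_classes) (auto simp: nonzero_paths_def)
  have "keys x \<subseteq> ?S \<longleftrightarrow> x \<in> rad" for x :: "('v, 'e) qpath \<Rightarrow>\<^sub>0 'k"
  proof
    assume x: "keys x \<subseteq> ?S"
    have "(v, []) \<notin> keys x" for v using x by (auto simp: path_length_def)
    moreover have "keys x \<subseteq> nonzero_paths" using x by (auto simp: nonzero_paths_def)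
    ultimately show "x \<in> rad" by (simp add: rad_def elems_def in_keys_iff)
  next
    assume x: "x \<in> rad"
    show "keys x \<subseteq> ?S"
    proof
      fix p assume p: "p \<in> keys x"
      then show "p \<in> ?S"
        using rad_keys[OF x p] keys_in_B[OF rad_elems[OF x] p]
        by (simp add: nonzero_paths_def path_length_def Suc_le_eq)
    qed
  qed
  then have "{x :: ('v, 'e) qpath \<Rightarrow>\<^sub>0 'k. keys x \<subseteq> ?S} = rad" by blast
  with \<open>A_plus Q I = _\<close> show ?thesis by (simp only:)
qed

lemma stationary_span_conv: "stationary_span Q I = cls ` {x. keys x \<subseteq> stationary ` verts Q}"
  unfolding stationary_span_def by (rule lin_span_path_classes) (use stationary_in_B in auto)

lemma Units_A:
  assumes "U \<in> Units A"
  obtains u w where "inverse_pair u w" "U = cls u" "inv\<^bsub>A\<^esub> U = cls w"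
proof -
  interpret ring A by (rule ring_A)
  have "U \<in> cls ` elems" "inv\<^bsub>A\<^esub> U \<in> cls ` elems"
    using Units_closed[OF assms] Units_inv_closed[OF assms] by (simp_all only: A_carrier)
  then obtain u w where uw: "u \<in> elems" "w \<in> elems" "U = cls u" "inv\<^bsub>A\<^esub> U = cls w"
    by blast
  have "cls (u \<star> w) = cls unity" "cls (w \<star> u) = cls unity"
    using Units_r_inv[OF assms] Units_l_inv[OF assms] uw by (simp_all add: A_mult A_one)
  then have "inverse_pair u w"
    using uw cls_inj[OF times_in_elems unity_in_elems] by (simp add: inverse_pair_def)
  then show ?thesis using that uw by blast
qed

lemma cls_Unit:
  assumes "inverse_pair u w"
  shows "cls u \<in> Units A" "inv\<^bsub>A\<^esub> (cls u) = cls w"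
proof -
  interpret ring A by (rule ring_A)
  have *: "cls u \<in> carrier A" "cls w \<in> carrier A" "cls w \<otimes>\<^bsub>A\<^esub> cls u = \<one>\<^bsub>A\<^esub>" "cls u \<otimes>\<^bsub>A\<^esub> cls w = \<one>\<^bsub>A\<^esub>"
    using assms by (simp_all add: inverse_pair_def A_mult A_one)
  then show "cls u \<in> Units A" by (auto simp: Units_def)
  show "inv\<^bsub>A\<^esub> (cls u) = cls w"
    by (rule inv_unique'[symmetric]) (use * in auto)
qed

lemma conj_map_cls:
  assumes "inverse_pair u w" "x \<in> elems"
  shows "conj_map A (cls u) (cls x) = cls (w \<star> x \<star> u)"
  using assms cls_Unit[OF assms(1)] by (simp add: conj_map_def A_mult inverse_pair_def)

lemma conj_map_auto:
  assumes uw: "inverse_pair u w"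
  shows "conj_map A (cls u) \<in> alg_auto A"
proof -
  let ?\<phi> = "conj_map A (cls u)"
  have cancel: "u \<star> (w \<star> x) = x" "w \<star> (u \<star> x) = x" if "x \<in> elems" for x
    using uw that by (simp_all add: inverse_pair_def unity_times times_assoc[symmetric])
  have el: "u \<in> elems" "w \<in> elems" using uw by (simp_all add: inverse_pair_def)
  have wu: "w \<star> u = unity" using uw by (simp add: inverse_pair_def)
  have hom: "?\<phi> \<in> ring_hom A A"
  proof (rule ring_hom_memI)
    fix X Y assume "X \<in> carrier A" "Y \<in> carrier A"
    then obtain x y where xy: "x \<in> elems" "y \<in> elems" "X = cls x" "Y = cls y"
      unfolding A_carrier by blast
    have "(w \<star> x \<star> u) \<star> (w \<star> y \<star> u) = w \<star> (x \<star> y) \<star> u"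
      using xy by (simp add: times_assoc cancel)
    then show "?\<phi> (X \<otimes>\<^bsub>A\<^esub> Y) = ?\<phi> X \<otimes>\<^bsub>A\<^esub> ?\<phi> Y"
      using xy by (simp add: A_mult conj_map_cls[OF uw])
    show "?\<phi> (X \<oplus>\<^bsub>A\<^esub> Y) = ?\<phi> X \<oplus>\<^bsub>A\<^esub> ?\<phi> Y"
      using xy by (simp add: A_add conj_map_cls[OF uw] times_add)
    show "?\<phi> X \<in> carrier A" using xy by (simp add: conj_map_cls[OF uw])
  next
    show "?\<phi> \<one>\<^bsub>A\<^esub> = \<one>\<^bsub>A\<^esub>"
      by (simp add: A_one conj_map_cls[OF uw] times_unity el wu)
  qed
  have vu: "inverse_pair w u" using uw by (simp add: inverse_pair_def)
  have inv1: "conj_map A (cls w) (?\<phi> X) = X" and inv2: "?\<phi> (conj_map A (cls w) X) = X"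
    if X: "X \<in> carrier A" for X
  proof -
    obtain x where x: "x \<in> elems" "X = cls x" using X unfolding A_carrier by blast
    have uw1: "u \<star> w = unity" using uw by (simp add: inverse_pair_def)
    have "u \<star> (w \<star> x \<star> u) \<star> w = x" "w \<star> (u \<star> x \<star> w) \<star> u = x"
      using x by (simp_all add: times_assoc cancel wu uw1 times_unity)
    then show "conj_map A (cls w) (?\<phi> X) = X" "?\<phi> (conj_map A (cls w) X) = X"
      using x by (simp_all add: conj_map_cls[OF uw] conj_map_cls[OF vu])
  qed
  have clos: "conj_map A (cls w) X \<in> carrier A" if "X \<in> carrier A" for X
    using that by (auto simp: A_carrier conj_map_cls[OF vu])
  have "bij_betw ?\<phi> (carrier A) (carrier A)"
    by (rule bij_betw_byWitness[where f' = "conj_map A (cls w)"])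
      (use inv1 inv2 clos ring_hom_memE(1)[OF hom] in auto)
  then have "?\<phi> \<in> Bij (carrier A)"
    by (simp add: Bij_def conj_map_def)
  moreover have "?\<phi> (a \<odot>\<^bsub>A\<^esub> X) = a \<odot>\<^bsub>A\<^esub> ?\<phi> X" if "X \<in> carrier A" for a X
    using that by (auto simp: A_carrier A_smult conj_map_cls[OF uw] scale_in_elems scale_times)
  ultimately show ?thesis using hom by (simp add: alg_auto_def)
qed

end

context string_relations
begin

section \<open>Factorization of automorphisms\<close>

lemma A_smult_closed: "X \<in> carrier A \<Longrightarrow> a \<odot>\<^bsub>A\<^esub> X \<in> carrier A"
  by (auto simp: A_carrier A_smult scale_in_elems)

lemma Inn_star_subset: "Inn_star Q I \<subseteq> alg_auto A"
proof
  fix k assume "k \<in> Inn_star Q I"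
  then obtain U where "k = conj_map A U" "U \<in> Units A" unfolding Inn_star_def by blast
  moreover obtain u w where "inverse_pair u w" "U = cls u"
    using Units_A[OF \<open>U \<in> Units A\<close>] by blast
  ultimately show "k \<in> alg_auto A" using conj_map_auto[of u w] by simp
qed

lemma conj_map_in_Inn_star:
  assumes "inverse_pair u w" "u - unity \<in> rad"
  shows "conj_map A (cls u) \<in> Inn_star Q I"
proof -
  have "\<one>\<^bsub>A\<^esub> \<oplus>\<^bsub>A\<^esub> cls (u - unity) = cls u"
    using rad_elems[OF assms(2)] by (simp add: A_one A_add)
  moreover have "cls (u - unity) \<in> A_plus Q I" using assms(2) by (simp add: A_plus_conv)
  ultimately show ?thesis
    using cls_Unit(1)[OF assms(1)] unfolding Inn_star_def
    by (intro CollectI exI[of _ "cls (u - unity)"]) simp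
qed

text \<open>With \<open>f v = \<phi>\<^sup>-\<^sup>1 (e v)\<close> and \<open>f (s v) = u (e v) u\<^sup>-\<^sup>1\<close>, put \<open>h z = \<phi> (u z u\<^sup>-\<^sup>1)\<close>. Then \<open>h (e v) = e (s v)\<close>,
so \<open>h\<close> preserves the span of the stationary paths, and \<open>\<phi>\<close> is \<open>h\<close> after conjugation by \<open>u\<close>.\<close>
lemma automorphism_factorization:
  assumes \<phi>: "\<phi> \<in> alg_auto A"
  obtains h k where "h \<in> H_hat Q I" "k \<in> Inn_star Q I" "\<phi> = compose (carrier A) h k"
proof -
  have hom: "\<phi> \<in> ring_hom A A" and Bij: "\<phi> \<in> Bij (carrier A)"
    and lin: "\<And>a X. X \<in> carrier A \<Longrightarrow> \<phi> (a \<odot>\<^bsub>A\<^esub> X) = a \<odot>\<^bsub>A\<^esub> \<phi> X"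
    using \<phi> by (simp_all add: alg_auto_def)
  have bij: "bij_betw \<phi> (carrier A) (carrier A)" using Bij by (simp add: Bij_def)
  have inj: "x = y" if "x \<in> elems" "y \<in> elems" "\<phi> (cls x) = \<phi> (cls y)" for x y
    using cls_inj[OF that(1,2)] inj_onD[OF bij_betw_imp_inj_on[OF bij] that(3)] that(1,2) by simp
  have add: "\<phi> (cls (x + y)) = \<phi> (cls x) \<oplus>\<^bsub>A\<^esub> \<phi> (cls y)" if "x \<in> elems" "y \<in> elems" for x y
    using ring_hom_memE(3)[OF hom, of "cls x" "cls y"] that by (simp add: A_add)
  have mult: "\<phi> (cls (x \<star> y)) = \<phi> (cls x) \<otimes>\<^bsub>A\<^esub> \<phi> (cls y)" if "x \<in> elems" "y \<in> elems" for x y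
    using ring_hom_memE(2)[OF hom, of "cls x" "cls y"] that by (simp add: A_mult)
  have scale0: "scale 0 x = 0" for x :: "('v, 'e) qpath \<Rightarrow>\<^sub>0 'k"
    by (rule poly_mapping_eqI) (simp add: lookup_smult)
  have zero: "\<phi> (cls 0) = cls 0"
  proof -
    have "\<phi> (cls 0) \<in> carrier A" by (rule ring_hom_memE(1)[OF hom]) simp
    then obtain x where "\<phi> (cls 0) = cls x" unfolding A_carrier by blast
    then have "0 \<odot>\<^bsub>A\<^esub> \<phi> (cls 0) = cls 0" by (simp add: A_smult scale0)
    moreover have "\<phi> (0 \<odot>\<^bsub>A\<^esub> cls 0) = 0 \<odot>\<^bsub>A\<^esub> \<phi> (cls 0)" by (rule lin) simp
    ultimately show ?thesis by (simp add: A_smult scale0)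
  qed
  have "\<exists>x\<in>elems. \<phi> (cls x) = cls (e v)" if v: "v \<in> verts Q" for v
  proof -
    have "cls (e v) \<in> \<phi> ` carrier A"
      using bij_betw_imp_surj_on[OF bij] v by simp
    then obtain X where "X \<in> carrier A" "\<phi> X = cls (e v)" by (rule imageE) simp
    moreover from this(1) obtain x where "x \<in> elems" "X = cls x" unfolding A_carrier by blast
    ultimately show ?thesis by blast
  qed
  then obtain f where f: "\<And>v. v \<in> verts Q \<Longrightarrow> f v \<in> elems" "\<And>v. v \<in> verts Q \<Longrightarrow> \<phi> (cls (f v)) = cls (e v)"
    by metis
  have f_sum: "(\<Sum>v\<in>V. f v) \<in> elems \<and> \<phi> (cls (\<Sum>v\<in>V. f v)) = cls (\<Sum>v\<in>V. e v)"
    if "finite V" "V \<subseteq> verts Q" for V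
    using that
  proof (induction V rule: finite_induct)
    case empty
    then show ?case by (simp add: zero)
  next
    case (insert v V)
    then show ?case
      using A_add[of "e v" "\<Sum>v\<in>V. e v"] by (simp add: add f elems_sum subset_iff)
  qed
  obtain s u w where s: "bij_betw s (verts Q) (verts Q)" and uw: "inverse_pair u w" "u - unity \<in> rad"
    and conj: "\<And>v. v \<in> verts Q \<Longrightarrow> f (s v) = u \<star> e v \<star> w"
  proof (rule idempotents_conjugate[of f])
    fix v assume v: "v \<in> verts Q"
    show "f v \<in> elems" by (rule f(1)[OF v])
    show "f v \<noteq> 0"
    proof
      assume "f v = 0"
      then have "cls (e v) = cls 0" using f(2)[OF v] zero by simp
      then have "e v = (0 :: ('v, 'e) qpath \<Rightarrow>\<^sub>0 'k)" by (rule cls_inj[rotated 2]) (simp_all add: v)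
      then have "lookup (e v :: ('v, 'e) qpath \<Rightarrow>\<^sub>0 'k) (v, []) = 0" by simp
      then show False by (simp add: lookup_e)
    qed
    fix w assume w: "w \<in> verts Q"
    show "f v \<star> f w = (if v = w then f v else 0)"
    proof (rule inj)
      have "\<phi> (cls (f v \<star> f w)) = cls (e v \<star> e w)"
        using f v w by (simp add: mult A_mult)
      then show "\<phi> (cls (f v \<star> f w)) = \<phi> (cls (if v = w then f v else 0))"
        using f v w by (simp add: e_times_e zero)
    qed (use f v w in simp_all)
  next
    have "\<phi> (cls unity) = cls unity" using ring_hom_memE(4)[OF hom] by (simp add: A_one)
    moreover have "(\<Sum>v\<in>verts Q. f v) \<in> elems" "\<phi> (cls (\<Sum>v\<in>verts Q. f v)) = cls unity"
      using f_sum[of "verts Q"] by (simp_all add: unity_def)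
    ultimately show "(\<Sum>v\<in>verts Q. f v) = unity"
      by (intro inj) simp_all
  qed blast
  have wu: "inverse_pair w u" using uw(1) by (simp add: inverse_pair_def)
  have el: "u \<in> elems" "w \<in> elems" "u \<star> w = unity" using uw(1) by (simp_all add: inverse_pair_def)
  define h where "h = compose (carrier A) \<phi> (conj_map A (cls w))"
  have h: "h (cls x) = \<phi> (cls (u \<star> x \<star> w))" if "x \<in> elems" for x
    using that by (simp add: h_def compose_def conj_map_cls[OF wu])
  have h_auto: "h \<in> alg_auto A"
    unfolding h_def
    using ring_A A_smult_closed \<phi> conj_map_auto[OF wu] by (rule alg_auto_compose)
  have h_e: "h (cls (scale a (e v))) = cls (scale a (e (s v)))" if v: "v \<in> verts Q" for a v
  proof -
    have sv: "s v \<in> verts Q" using bij_betwE[OF s] v by blast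
    have "h (cls (scale a (e v))) = \<phi> (cls (u \<star> scale a (e v) \<star> w))"
      by (rule h, rule scale_in_elems, rule e_in_elems, rule v)
    also have "u \<star> scale a (e v) \<star> w = scale a (f (s v))"
      by (simp only: scale_times conj[OF v])
    also have "\<phi> (cls (scale a (f (s v)))) = a \<odot>\<^bsub>A\<^esub> \<phi> (cls (f (s v)))"
      using lin[of "cls (f (s v))" a] f(1)[OF sv] by (simp only: A_smult cls_in_A)
    also have "\<dots> = cls (scale a (e (s v)))"
      by (simp only: f(2)[OF sv] A_smult)
    finally show ?thesis .
  qed
  have h_add: "h (cls (x + y)) = h (cls x) \<oplus>\<^bsub>A\<^esub> h (cls y)" if "x \<in> elems" "y \<in> elems" for x y
    using that add by (simp add: h times_add)
  have h_zero: "h (cls 0) = cls 0" by (simp add: h zero)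
  have span: "h ` stationary_span Q I \<subseteq> stationary_span Q I"
  proof
    fix Y assume "Y \<in> h ` stationary_span Q I"
    then obtain x where x: "keys x \<subseteq> stationary ` verts Q" "Y = h (cls x)"
      unfolding stationary_span_conv by blast
    let ?a = "\<lambda>v. lookup x (stationary v)"
    have el_sum: "(\<Sum>v\<in>V. scale (?a v) (e (t v))) \<in> elems" if "\<And>v. v \<in> V \<Longrightarrow> t v \<in> verts Q" for V t
      using that by (intro elems_sum scale_in_elems) simp
    have sV: "s v \<in> verts Q" if "v \<in> verts Q" for v using bij_betwE[OF s] that by blast
    have h_sum: "h (cls (\<Sum>v\<in>V. scale (?a v) (e v))) = cls (\<Sum>v\<in>V. scale (?a v) (e (s v)))"
      if "finite V" "V \<subseteq> verts Q" for V
      using that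
    proof (induction V rule: finite_induct)
      case empty
      then show ?case by (simp add: h_zero)
    next
      case (insert v V)
      have v: "v \<in> verts Q" and V: "V \<subseteq> verts Q" using insert.prems by auto
      have "h (cls (\<Sum>v\<in>insert v V. scale (?a v) (e v)))
          = h (cls (scale (?a v) (e v))) \<oplus>\<^bsub>A\<^esub> h (cls (\<Sum>v\<in>V. scale (?a v) (e v)))"
        using insert.hyps h_add[OF scale_in_elems[OF e_in_elems[OF v]] el_sum[of V "\<lambda>v. v"]] V by auto
      also have "\<dots> = cls (scale (?a v) (e (s v))) \<oplus>\<^bsub>A\<^esub> cls (\<Sum>v\<in>V. scale (?a v) (e (s v)))"
        using insert.IH[OF V] h_e[OF v] by simp
      also have "\<dots> = cls (\<Sum>v\<in>insert v V. scale (?a v) (e (s v)))"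
        using insert.hyps A_add[OF scale_in_elems[OF e_in_elems[OF sV[OF v]]] el_sum[of V s]] V sV
        by auto
      finally show ?case .
    qed
    have "(\<Sum>v\<in>verts Q. scale (?a v) (e v)) = x"
    proof -
      have "inj_on (stationary :: 'v \<Rightarrow> ('v, 'e) qpath) (verts Q)" by (rule inj_onI) (simp add: stationary_def)
      then have "(\<Sum>v\<in>verts Q. scale (?a v) (e v))
          = (\<Sum>p\<in>stationary ` verts Q. Poly_Mapping.single p (lookup x p))"
        by (simp add: sum.reindex scale_single)
      also have "\<dots> = x" by (rule poly_mapping_sum_single) (use x(1) in simp_all)
      finally show ?thesis .
    qed
    with h_sum[OF finite_verts subset_refl]
    have "Y = cls (\<Sum>v\<in>verts Q. scale (?a v) (e (s v)))" by (simp only: x(2))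
    moreover have "keys (\<Sum>v\<in>verts Q. scale (?a v) (e (s v))) \<subseteq> stationary ` verts Q"
    proof
      fix p assume "p \<in> keys (\<Sum>v\<in>verts Q. scale (?a v) (e (s v)))"
      then have "(\<Sum>v\<in>verts Q. lookup (scale (?a v) (e (s v))) p) \<noteq> 0"
        by (simp add: in_keys_iff lookup_sum)
      then obtain v where "v \<in> verts Q" "lookup (scale (?a v) (e (s v))) p \<noteq> 0"
        by (rule sum.not_neutral_contains_not_neutral)
      then show "p \<in> stationary ` verts Q"
        using sV by (auto simp: lookup_smult lookup_single when_def split: if_splits)
    qed
    ultimately show "Y \<in> stationary_span Q I" unfolding stationary_span_conv by blast
  qed
  have k: "conj_map A (cls u) \<in> Inn_star Q I" by (rule conj_map_in_Inn_star[OF uw])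
  have "\<phi> = compose (carrier A) h (conj_map A (cls u))"
  proof (rule extensionalityI[of _ "carrier A"])
    show "\<phi> \<in> extensional (carrier A)" using Bij by (simp add: Bij_def)
    fix X assume X: "X \<in> carrier A"
    then obtain x where x: "x \<in> elems" "X = cls x" unfolding A_carrier by blast
    have "u \<star> (w \<star> x \<star> u) \<star> w = (u \<star> w) \<star> x \<star> (u \<star> w)" by (simp add: times_assoc)
    also have "\<dots> = x" unfolding el(3) using x by (simp add: unity_times times_unity)
    finally show "\<phi> X = compose (carrier A) h (conj_map A (cls u)) X"
      using x by (simp add: compose_def conj_map_cls[OF uw(1)] h)
  qed (simp add: compose_def)
  then show ?thesis using that h_auto span k unfolding H_hat_def by blast
qed

end

theorem corollary6p3:
  fixes Q :: "('v, 'e) pre_digraph" and I :: "(('v, 'e) qpath \<Rightarrow>\<^sub>0 'k::field) set"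
  assumes "string_algebra Q I \<or> locally_string_algebra Q I"
  shows "carrier (AutAlg (quiver_algebra Q I)) =
    H_hat Q I <#>\<^bsub>AutAlg (quiver_algebra Q I)\<^esub> Inn_star Q I"
proof -
  have "string_relations Q I"
    using assms string_algebra.axioms(1) locally_string_algebra.axioms(1) by blast
  then interpret string_relations Q I .
  have mult: "h \<otimes>\<^bsub>AutAlg A\<^esub> k = compose (carrier A) h k" if "h \<in> alg_auto A" "k \<in> alg_auto A" for h k
    using that by (simp add: AutAlg_def BijGroup_def alg_auto_def)
  have carrier: "carrier (AutAlg A) = alg_auto A" by (simp add: AutAlg_def)
  have H: "H_hat Q I \<subseteq> alg_auto A" by (auto simp: H_hat_def)
  show ?thesis
    unfolding carrier
  proof (intro equalityI subsetI)
    fix \<phi> assume "\<phi> \<in> alg_auto A"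
    then obtain h k where hk: "h \<in> H_hat Q I" "k \<in> Inn_star Q I" "\<phi> = compose (carrier A) h k"
      by (rule automorphism_factorization)
    then have "h \<in> alg_auto A" "k \<in> alg_auto A" using H Inn_star_subset by auto
    then have "\<phi> = h \<otimes>\<^bsub>AutAlg A\<^esub> k" using hk(3) mult[of h k] by simp
    then show "\<phi> \<in> H_hat Q I <#>\<^bsub>AutAlg A\<^esub> Inn_star Q I"
      using hk unfolding set_mult_def by blast
  next
    fix \<phi> assume "\<phi> \<in> H_hat Q I <#>\<^bsub>AutAlg A\<^esub> Inn_star Q I"
    then obtain h k where hk: "h \<in> H_hat Q I" "k \<in> Inn_star Q I" "\<phi> = h \<otimes>\<^bsub>AutAlg A\<^esub> k"
      unfolding set_mult_def by blast
    then have auto: "h \<in> alg_auto A" "k \<in> alg_auto A" using H Inn_star_subset by auto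
    have "compose (carrier A) h k \<in> alg_auto A"
      using ring_A A_smult_closed auto by (rule alg_auto_compose)
    then show "\<phi> \<in> alg_auto A" using hk(3) mult[OF auto] by simp
  qed
qed

end
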